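(* Let $p$ be a prime, $k=\mathbb{F}_p$ and $K=\mathbb{F}_{p^2}$, so that $k<K$. (i) Suppose that $p$ is odd, let $d\in\mathbb{F}_p$ be a non-square, and represent $K=\{x+y\sqrt d: x,y\in\mathbb{F}_p\}$. Let $W_0=k\sqrt d$ and $W_a=k(1+a\sqrt d)$ for $0\ne a\in\mathbb{F}_p$. If $a,b\in k$, then the automorphic loops $Q_{k<K}(W_a)$ and $Q_{k<K}(W_b)$ of order $p^3$ are isomorphic if and only if $a=\pm b$. In particular, there are, up to isomorphism, precisely $(p+1)/2$ automorphic loops of order $p^3$ of the form $Q_{k<K}(W)$ (with $W$ a $k$-subspace of $K$, $k\cap W=0$), and as representatives one can take $W\in\{W_a: 0\le a\le (p-1)/2\}$. (ii) Suppose that $p=2$. Then there is a unique automorphic loop of order $p^3$ of the form $Q_{k<K}(W)$ (with $W$ a $k$-subspace of $K$, $k\cap W=0$) up to isomorphism.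
   Context: For a field extension $k<K$ and a $k$-subspace $W$ of $K$ with $k\cap W=0$, $Q_{k<K}(W)$ denotes the set $W\times K$ with multiplication $(a,u)(b,v)=(a+b,\;u(1+b)+v(1-a))$, where all operations on the right are those of $K$. A loop is a set $Q$ with a binary operation having a two-sided identity element and such that all translations $L_x:y\mapsto xy$ and $R_x:y\mapsto yx$ are bijections. A loop is automorphic if every element of the group generated by all $L_x,R_x$ that fixes the identity element is an automorphism of the loop. *)

theory Defs
  imports "HOL-Algebra.Algebra"
begin

text \<open>A binary operation together with its identity element is a \<^typ>\<open>'a monoid\<close> record; no
  associativity is implied, and \<^const>\<open>iso\<close>, \<^const>\<open>auto\<close> and \<^const>\<open>order\<close> only refer to the
  carrier and the multiplication.\<close>

locale algebraic_loop =
  fixes Q :: "('a, 'b) monoid_scheme" (structure)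
  assumes m_closed: "\<lbrakk>x \<in> carrier Q; y \<in> carrier Q\<rbrakk> \<Longrightarrow> x \<otimes> y \<in> carrier Q"
    and one_closed: "\<one> \<in> carrier Q"
    and l_one: "x \<in> carrier Q \<Longrightarrow> \<one> \<otimes> x = x"
    and r_one: "x \<in> carrier Q \<Longrightarrow> x \<otimes> \<one> = x"
    and left_translation_bij:
      "x \<in> carrier Q \<Longrightarrow> bij_betw (\<lambda>y. x \<otimes> y) (carrier Q) (carrier Q)"
    and right_translation_bij:
      "x \<in> carrier Q \<Longrightarrow> bij_betw (\<lambda>y. y \<otimes> x) (carrier Q) (carrier Q)"

definition left_translation :: "('a, 'b) monoid_scheme \<Rightarrow> 'a \<Rightarrow> 'a \<Rightarrow> 'a" where
  "left_translation Q x = (\<lambda>y \<in> carrier Q. x \<otimes>\<^bsub>Q\<^esub> y)"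

definition right_translation :: "('a, 'b) monoid_scheme \<Rightarrow> 'a \<Rightarrow> 'a \<Rightarrow> 'a" where
  "right_translation Q x = (\<lambda>y \<in> carrier Q. y \<otimes>\<^bsub>Q\<^esub> x)"

definition multiplication_group :: "('a, 'b) monoid_scheme \<Rightarrow> ('a \<Rightarrow> 'a) set" where
  "multiplication_group Q =
     generate (BijGroup (carrier Q))
       (left_translation Q ` carrier Q \<union> right_translation Q ` carrier Q)"

locale automorphic_loop = algebraic_loop +
  assumes inner_mapping_auto:
    "\<lbrakk>f \<in> multiplication_group Q; f \<one> = \<one>\<rbrakk> \<Longrightarrow> f \<in> auto Q"

text \<open>The subfield \<open>k\<close> does not occur in the multiplication of \<open>Q\<^bsub>k<K\<^esub>(W)\<close>; it only restricts
  the choice of \<open>W\<close>, see \<open>admissible_subspace\<close> below.\<close>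

definition Q_loop :: "('a, 'b) ring_scheme \<Rightarrow> 'a set \<Rightarrow> ('a \<times> 'a) monoid" where
  "Q_loop K W =
     \<lparr>carrier = W \<times> carrier K,
      monoid.mult = (\<lambda>(a, u) (b, v).
        (a \<oplus>\<^bsub>K\<^esub> b, u \<otimes>\<^bsub>K\<^esub> (\<one>\<^bsub>K\<^esub> \<oplus>\<^bsub>K\<^esub> b) \<oplus>\<^bsub>K\<^esub> v \<otimes>\<^bsub>K\<^esub> (\<one>\<^bsub>K\<^esub> \<ominus>\<^bsub>K\<^esub> a))),
      one = (\<zero>\<^bsub>K\<^esub>, \<zero>\<^bsub>K\<^esub>)\<rparr>"

text \<open>\<^term>\<open>subalgebra k W K\<close> says that \<open>W\<close> is an additive subgroup of \<open>K\<close> closed under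
  multiplication by elements of \<open>k\<close>, i.e. a \<open>k\<close>-subspace.\<close>

definition admissible_subspace :: "('a, 'b) ring_scheme \<Rightarrow> 'a set \<Rightarrow> 'a set \<Rightarrow> bool" where
  "admissible_subspace K k W \<longleftrightarrow> subalgebra k W K \<and> k \<inter> W = {\<zero>\<^bsub>K\<^esub>}"

definition automorphic_Q_loops ::
    "('a, 'b) ring_scheme \<Rightarrow> 'a set \<Rightarrow> nat \<Rightarrow> ('a \<times> 'a) monoid set" where
  "automorphic_Q_loops K k n =
     {Q_loop K W | W. admissible_subspace K k W \<and> automorphic_loop (Q_loop K W) \<and> order (Q_loop K W) = n}"

definition iso_on :: "('a, 'b) monoid_scheme set \<Rightarrow> (('a, 'b) monoid_scheme \<times> ('a, 'b) monoid_scheme) set"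
  where "iso_on S = {(A, B). A \<in> S \<and> B \<in> S \<and> A \<cong> B}"

text \<open>The lines \<open>W\<^sub>0 = k\<surd>d\<close> and \<open>W\<^sub>a = k(1 + a\<surd>d)\<close> for \<open>a \<noteq> 0\<close>, where \<open>s\<close> is the chosen square
  root of \<open>d\<close> in \<open>K\<close>.\<close>

definition W_line :: "('a, 'b) ring_scheme \<Rightarrow> 'a set \<Rightarrow> 'a \<Rightarrow> 'a \<Rightarrow> 'a set" where
  "W_line K k s a =
     (if a = \<zero>\<^bsub>K\<^esub> then {c \<otimes>\<^bsub>K\<^esub> s | c. c \<in> k}
      else {c \<otimes>\<^bsub>K\<^esub> (\<one>\<^bsub>K\<^esub> \<oplus>\<^bsub>K\<^esub> a \<otimes>\<^bsub>K\<^esub> s) | c. c \<in> k})"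

end

theory Submission
  imports Defs
begin

text \<open>
  In \<open>Q = Q\<^bsub>k<K\<^esub>(W)\<close> every left and every right translation has the form
  \<open>(x, y) \<mapsto> (x + c, \<alpha>y + \<beta>x + \<gamma>)\<close> with \<open>\<alpha> \<noteq> 0\<close>; here \<open>\<alpha>\<close> is \<open>1 - a\<close> or \<open>1 + a\<close> for some
  \<open>a \<in> W\<close>, and neither vanishes because \<open>1 \<notin> W\<close>. All maps of this form make up a group, and those that
  fix \<open>(0, 0)\<close> are \<open>(x, y) \<mapsto> (x, \<alpha>y + \<beta>x)\<close>. A one-line calculation shows that these are
  automorphisms of \<open>Q\<close>, so \<open>Q\<close> is automorphic (\<open>Q_loop_automorphic\<close>).

  An admissible \<open>W\<close> for which \<open>Q\<close> has order \<open>p\<^sup>3\<close> has \<open>p\<close> elements, so it is a line \<open>ke\<close> with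
  \<open>e \<notin> k\<close>. Such an \<open>e\<close> is a root of a polynomial \<open>X\<^sup>2 - tX + n\<close> over \<open>k\<close>, whose other root
  is \<open>t - e\<close>. Any automorphism of the field that takes \<open>W\<close> to \<open>W'\<close>, applied in both coordinates,
  is an isomorphism of the loops; hence \<open>ke\<close> and \<open>k(t - e)\<close> give isomorphic loops.

  For odd \<open>p\<close> there are no further isomorphisms. An isomorphism from \<open>Q\<^bsub>k<K\<^esub>(W)\<close> to
  \<open>Q\<^bsub>k<K\<^esub>(W')\<close> maps the fibre \<open>0 \<times> K\<close> to itself, since an element outside this fibre commutes
  with fewer elements than one inside. The restriction \<open>g\<close> to the fibre is additive.
  Applying the isomorphism to the relation \<open>(a, 0)(0, u(1 + a)) = (0, u(1 - a))(a, 0)\<close> yields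
  \<open>g(ua) = g(u) f(a)\<close>, where \<open>f : W \<rightarrow> W'\<close> is the induced map
  (\<open>Q_loop_iso_semilinear\<close>). As \<open>k\<close> is the prime field, \<open>g\<close> is \<open>k\<close>-linear, so \<open>f(e)\<close> satisfies
  the quadratic equation of \<open>e\<close>. Thus \<open>f(e)\<close> is \<open>e\<close> or \<open>t - e\<close>, and \<open>W'\<close> is \<open>ke\<close> or
  \<open>k(t - e)\<close> (\<open>Q_loop_line_iso_iff\<close>).

  With \<open>s\<^sup>2 = d\<close>, the lines other than \<open>k\<close> are exactly the \<open>W\<^sub>a\<close> with \<open>a \<in> k\<close>, and conjugation
  exchanges \<open>W\<^sub>a\<close> and \<open>W\<^sub>-\<^sub>a\<close>. The isomorphism classes therefore correspond to \<open>k\<close> modulo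
  sign, which has \<open>(p + 1)/2\<close> elements. For \<open>p = 2\<close> only two elements lie outside \<open>k\<close>, and they are
  conjugate, so that there is a single class.
\<close>

section \<open>Automorphic loops from subspaces of a field\<close>

lemma carrier_Q_loop [simp]: "carrier (Q_loop K W) = W \<times> carrier K"
  and one_Q_loop [simp]: "\<one>\<^bsub>Q_loop K W\<^esub> = (\<zero>\<^bsub>K\<^esub>, \<zero>\<^bsub>K\<^esub>)"
  and mult_Q_loop [simp]: "(a, u) \<otimes>\<^bsub>Q_loop K W\<^esub> (b, v) =
    (a \<oplus>\<^bsub>K\<^esub> b, u \<otimes>\<^bsub>K\<^esub> (\<one>\<^bsub>K\<^esub> \<oplus>\<^bsub>K\<^esub> b) \<oplus>\<^bsub>K\<^esub> v \<otimes>\<^bsub>K\<^esub> (\<one>\<^bsub>K\<^esub> \<ominus>\<^bsub>K\<^esub> a))"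
  by (simp_all add: Q_loop_def)

text \<open>Translations of the loop, and everything they generate, are of this form. The functions are
  restricted to the carrier because \<^const>\<open>BijGroup\<close> consists of extensional functions.\<close>

definition shear :: "('a, 'b) ring_scheme \<Rightarrow> 'a set \<Rightarrow> 'a \<Rightarrow> 'a \<Rightarrow> 'a \<Rightarrow> 'a \<Rightarrow> 'a \<times> 'a \<Rightarrow> 'a \<times> 'a" where
  "shear K W c \<alpha> \<beta> \<gamma> =
     (\<lambda>(x, y) \<in> W \<times> carrier K. (x \<oplus>\<^bsub>K\<^esub> c, \<alpha> \<otimes>\<^bsub>K\<^esub> y \<oplus>\<^bsub>K\<^esub> \<beta> \<otimes>\<^bsub>K\<^esub> x \<oplus>\<^bsub>K\<^esub> \<gamma>))"

definition shears :: "('a, 'b) ring_scheme \<Rightarrow> 'a set \<Rightarrow> ('a \<times> 'a \<Rightarrow> 'a \<times> 'a) set" where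
  "shears K W = {shear K W c \<alpha> \<beta> \<gamma> | c \<alpha> \<beta> \<gamma>.
     c \<in> W \<and> \<alpha> \<in> carrier K - {\<zero>\<^bsub>K\<^esub>} \<and> \<beta> \<in> carrier K \<and> \<gamma> \<in> carrier K}"

context field
begin

lemma shearsI:
  "c \<in> W \<Longrightarrow> \<alpha> \<in> carrier R \<Longrightarrow> \<alpha> \<noteq> \<zero> \<Longrightarrow> \<beta> \<in> carrier R \<Longrightarrow> \<gamma> \<in> carrier R \<Longrightarrow>
    shear R W c \<alpha> \<beta> \<gamma> \<in> shears R W"
  unfolding shears_def by blast

lemma shear_apply [simp]:
  "x \<in> W \<Longrightarrow> y \<in> carrier R \<Longrightarrow> shear R W c \<alpha> \<beta> \<gamma> (x, y) = (x \<oplus> c, \<alpha> \<otimes> y \<oplus> \<beta> \<otimes> x \<oplus> \<gamma>)"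
  by (simp add: shear_def)

text \<open>The coefficients of the inverse result from solving
  \<open>(x', y') = (x + c, \<alpha>y + \<beta>x + \<gamma>)\<close> for \<open>(x, y)\<close>.\<close>

lemma shear_inverse:
  assumes W: "subgroup W (add_monoid R)"
    and c: "c \<in> W" and \<alpha>: "\<alpha> \<in> carrier R" "\<alpha> \<noteq> \<zero>" and \<beta>: "\<beta> \<in> carrier R" and \<gamma>: "\<gamma> \<in> carrier R"
    and x: "x \<in> W" and y: "y \<in> carrier R"
  defines "g \<equiv> shear R W (\<ominus> c) (inv \<alpha>) (\<ominus> (inv \<alpha> \<otimes> \<beta>)) (inv \<alpha> \<otimes> (\<beta> \<otimes> c \<ominus> \<gamma>))"
  shows "g (shear R W c \<alpha> \<beta> \<gamma> (x, y)) = (x, y)" "shear R W c \<alpha> \<beta> \<gamma> (g (x, y)) = (x, y)"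
proof -
  interpret W: subgroup W "add_monoid R" by (rule W)
  have cl: "x \<in> carrier R" "c \<in> carrier R" "x \<oplus> c \<in> W" "\<ominus> c \<in> W" "x \<oplus> (\<ominus> c) \<in> W"
    using W.mem_carrier W.m_closed W.m_inv_closed x c by (auto simp: a_inv_def)
  have i: "inv \<alpha> \<in> carrier R" "\<alpha> \<otimes> inv \<alpha> = \<one>"
    using \<alpha> by (auto simp: field_Units)
  note s = cl i(1) \<alpha>(1) \<beta> \<gamma> y
  have "x \<oplus> c \<oplus> \<ominus> c = x" "x \<oplus> (\<ominus> c) \<oplus> c = x" using s by algebra+
  moreover have "inv \<alpha> \<otimes> (\<alpha> \<otimes> y \<oplus> \<beta> \<otimes> x \<oplus> \<gamma>) \<oplus> \<ominus> (inv \<alpha> \<otimes> \<beta>) \<otimes> (x \<oplus> c) \<oplus> inv \<alpha> \<otimes> (\<beta> \<otimes> c \<ominus> \<gamma>) = y"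
  proof -
    have "inv \<alpha> \<otimes> (\<alpha> \<otimes> y \<oplus> \<beta> \<otimes> x \<oplus> \<gamma>) \<oplus> \<ominus> (inv \<alpha> \<otimes> \<beta>) \<otimes> (x \<oplus> c) \<oplus> inv \<alpha> \<otimes> (\<beta> \<otimes> c \<ominus> \<gamma>) = (\<alpha> \<otimes> inv \<alpha>) \<otimes> y"
      using s by algebra
    thus ?thesis using i y by simp
  qed
  moreover have "\<alpha> \<otimes> (inv \<alpha> \<otimes> y \<oplus> \<ominus> (inv \<alpha> \<otimes> \<beta>) \<otimes> x \<oplus> inv \<alpha> \<otimes> (\<beta> \<otimes> c \<ominus> \<gamma>)) \<oplus> \<beta> \<otimes> (x \<oplus> (\<ominus> c)) \<oplus> \<gamma> = y"
  proof -
    have "\<alpha> \<otimes> (inv \<alpha> \<otimes> y \<oplus> \<ominus> (inv \<alpha> \<otimes> \<beta>) \<otimes> x \<oplus> inv \<alpha> \<otimes> (\<beta> \<otimes> c \<ominus> \<gamma>)) \<oplus> \<beta> \<otimes> (x \<oplus> (\<ominus> c)) \<oplus> \<gamma>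
      = (\<alpha> \<otimes> inv \<alpha>) \<otimes> (y \<oplus> \<beta> \<otimes> (c \<ominus> x) \<ominus> \<gamma>) \<oplus> (\<beta> \<otimes> (x \<ominus> c) \<oplus> \<gamma>)"
      using s by algebra
    also have "\<dots> = y" unfolding i(2) using s by algebra
    finally show ?thesis .
  qed
  ultimately show "g (shear R W c \<alpha> \<beta> \<gamma> (x, y)) = (x, y)" "shear R W c \<alpha> \<beta> \<gamma> (g (x, y)) = (x, y)"
    using x s unfolding g_def by simp_all
qed

lemma shear_inverse_in_shears:
  assumes W: "subgroup W (add_monoid R)" and f: "f \<in> shears R W"
  obtains g where "g \<in> shears R W"
    "\<And>z. z \<in> W \<times> carrier R \<Longrightarrow> g (f z) = z" "\<And>z. z \<in> W \<times> carrier R \<Longrightarrow> f (g z) = z"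
proof -
  interpret W: subgroup W "add_monoid R" by (rule W)
  from f obtain c \<alpha> \<beta> \<gamma> where f: "f = shear R W c \<alpha> \<beta> \<gamma>" and
    cs: "c \<in> W" "\<alpha> \<in> carrier R" "\<alpha> \<noteq> \<zero>" "\<beta> \<in> carrier R" "\<gamma> \<in> carrier R"
    by (auto simp: shears_def)
  let ?g = "shear R W (\<ominus> c) (inv \<alpha>) (\<ominus> (inv \<alpha> \<otimes> \<beta>)) (inv \<alpha> \<otimes> (\<beta> \<otimes> c \<ominus> \<gamma>))"
  have i: "inv \<alpha> \<in> carrier R - {\<zero>}" "\<ominus> c \<in> W" "c \<in> carrier R"
    using cs field_Units W.m_inv_closed W.mem_carrier Units_inv_Units by (auto simp: a_inv_def)
  have "?g \<in> shears R W"
    unfolding shears_def using cs i by blast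
  thus ?thesis
    using that[of ?g] shear_inverse[OF W cs] unfolding f by force
qed

lemma shear_closed:
  assumes W: "subgroup W (add_monoid R)" and f: "f \<in> shears R W" and z: "z \<in> W \<times> carrier R"
  shows "f z \<in> W \<times> carrier R"
proof -
  interpret W: subgroup W "add_monoid R" by (rule W)
  show ?thesis using f z W.m_closed W.mem_carrier by (auto simp: shears_def)
qed

lemma shears_in_Bij:
  assumes W: "subgroup W (add_monoid R)" and f: "f \<in> shears R W"
  shows "f \<in> Bij (W \<times> carrier R)"
proof -
  obtain g where g: "g \<in> shears R W"
    "\<And>z. z \<in> W \<times> carrier R \<Longrightarrow> g (f z) = z" "\<And>z. z \<in> W \<times> carrier R \<Longrightarrow> f (g z) = z"
    by (rule shear_inverse_in_shears[OF W f]) blast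
  have "f \<in> extensional (W \<times> carrier R)"
    using f by (auto simp: shears_def shear_def)
  moreover have "bij_betw f (W \<times> carrier R) (W \<times> carrier R)"
    by (rule bij_betw_byWitness[where f' = g])
      (use g shear_closed[OF W f] shear_closed[OF W g(1)] in \<open>blast+\<close>)
  ultimately show ?thesis by (simp add: Bij_def)
qed

text \<open>The composition of two shears is again one because the second coordinate is affine in
  \<open>(x, y)\<close> and the first is a translation of \<open>x\<close> alone.\<close>

lemma shears_subgroup:
  assumes W: "subgroup W (add_monoid R)"
  shows "subgroup (shears R W) (BijGroup (W \<times> carrier R))"
proof -
  interpret W: subgroup W "add_monoid R" by (rule W)
  let ?S = "W \<times> carrier R"
  interpret B: group "BijGroup ?S" by (rule group_BijGroup)
  have comp: "compose ?S f g \<in> shears R W" if fg: "f \<in> shears R W" "g \<in> shears R W" for f g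
  proof -
    from fg obtain c \<alpha> \<beta> \<gamma> c' \<alpha>' \<beta>' \<gamma>' where
      f: "f = shear R W c \<alpha> \<beta> \<gamma>" "c \<in> W" "\<alpha> \<in> carrier R" "\<alpha> \<noteq> \<zero>" "\<beta> \<in> carrier R" "\<gamma> \<in> carrier R" and
      g: "g = shear R W c' \<alpha>' \<beta>' \<gamma>'" "c' \<in> W" "\<alpha>' \<in> carrier R" "\<alpha>' \<noteq> \<zero>" "\<beta>' \<in> carrier R" "\<gamma>' \<in> carrier R"
      by (auto simp: shears_def)
    have cl: "c \<in> carrier R" "c' \<in> carrier R" "c' \<oplus> c \<in> W"
      using f g W.mem_carrier W.m_closed by auto
    let ?h = "shear R W (c' \<oplus> c) (\<alpha> \<otimes> \<alpha>') (\<alpha> \<otimes> \<beta>' \<oplus> \<beta>) (\<alpha> \<otimes> \<gamma>' \<oplus> \<beta> \<otimes> c' \<oplus> \<gamma>)"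
    have "compose ?S f g = ?h"
    proof (rule extensionalityI[of _ ?S])
      show "compose ?S f g \<in> extensional ?S" by simp
      show "?h \<in> extensional ?S" by (auto simp: shear_def)
      fix z assume "z \<in> ?S"
      then obtain x y where z: "z = (x, y)" "x \<in> W" "y \<in> carrier R" by auto
      have x: "x \<in> carrier R" "x \<oplus> c' \<in> W" using z g W.mem_carrier W.m_closed by auto
      note s = f(2-) g(2-) cl x z(2-)
      have "x \<oplus> c' \<oplus> c = x \<oplus> (c' \<oplus> c)" using s by algebra
      moreover have "\<alpha> \<otimes> (\<alpha>' \<otimes> y \<oplus> \<beta>' \<otimes> x \<oplus> \<gamma>') \<oplus> \<beta> \<otimes> (x \<oplus> c') \<oplus> \<gamma>
          = \<alpha> \<otimes> \<alpha>' \<otimes> y \<oplus> (\<alpha> \<otimes> \<beta>' \<oplus> \<beta>) \<otimes> x \<oplus> (\<alpha> \<otimes> \<gamma>' \<oplus> \<beta> \<otimes> c' \<oplus> \<gamma>)"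
        using s by algebra
      ultimately show "compose ?S f g z = ?h z"
        using s by (simp add: compose_def f(1) g(1) z(1))
    qed
    moreover have "?h \<in> shears R W"
      unfolding shears_def using f g cl integral by blast
    ultimately show ?thesis by simp
  qed
  have one: "\<one>\<^bsub>BijGroup ?S\<^esub> \<in> shears R W"
  proof -
    have "\<one>\<^bsub>BijGroup ?S\<^esub> = shear R W \<zero> \<one> \<zero> \<zero>"
      using W.mem_carrier by (fastforce simp: BijGroup_def shear_def)
    thus ?thesis using W.one_closed by (simp add: shearsI)
  qed
  have mult: "f \<otimes>\<^bsub>BijGroup ?S\<^esub> g = compose ?S f g" if "f \<in> shears R W" "g \<in> shears R W" for f g
    using that shears_in_Bij[OF W] by (simp add: BijGroup_def)
  show ?thesis
  proof (rule B.subgroupI)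
    show "shears R W \<subseteq> carrier (BijGroup ?S)"
      using shears_in_Bij[OF W] by (auto simp: BijGroup_def)
    show "shears R W \<noteq> {}" using one by blast
    show "f \<otimes>\<^bsub>BijGroup ?S\<^esub> g \<in> shears R W" if "f \<in> shears R W" "g \<in> shears R W" for f g
      using that comp mult by simp
    fix f assume f: "f \<in> shears R W"
    obtain g where g: "g \<in> shears R W" "\<And>z. z \<in> ?S \<Longrightarrow> g (f z) = z"
      by (rule shear_inverse_in_shears[OF W f]) blast
    have "g \<otimes>\<^bsub>BijGroup ?S\<^esub> f = \<one>\<^bsub>BijGroup ?S\<^esub>"
      unfolding mult[OF g(1) f] using g(2) by (auto simp: BijGroup_def compose_def)
    hence "inv\<^bsub>BijGroup ?S\<^esub> f = g"
      using f g(1) shears_in_Bij[OF W] by (intro B.inv_equality) (auto simp: BijGroup_def)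
    thus "inv\<^bsub>BijGroup ?S\<^esub> f \<in> shears R W" using g(1) by simp
  qed
qed

text \<open>The product \<open>(a + b, u(1 + b) + v(1 - a))\<close> is affine in \<open>(b, v)\<close> for fixed \<open>(a, u)\<close> and vice
  versa; the coefficient of the moving second coordinate is \<open>1 - a\<close> or \<open>1 + b\<close>, respectively.\<close>

lemma Q_loop_translations_in_shears:
  assumes W: "subgroup W (add_monoid R)" and 1: "\<one> \<notin> W" and z: "z \<in> W \<times> carrier R"
  shows "left_translation (Q_loop R W) z \<in> shears R W"
    and "right_translation (Q_loop R W) z \<in> shears R W"
proof -
  interpret W: subgroup W "add_monoid R" by (rule W)
  obtain a u where z: "z = (a, u)" "a \<in> W" "u \<in> carrier R" using z by auto
  have a: "a \<in> carrier R" using W.mem_carrier z by auto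
  have ne: "\<one> \<ominus> a \<noteq> \<zero>" "\<one> \<oplus> a \<noteq> \<zero>"
  proof -
    show "\<one> \<ominus> a \<noteq> \<zero>" using z 1 a by auto
    have "\<ominus> a \<in> W" using W.m_inv_closed z by (auto simp: a_inv_def)
    thus "\<one> \<oplus> a \<noteq> \<zero>" using 1 a by (metis minus_equality one_closed minus_minus)
  qed
  have "left_translation (Q_loop R W) z = shear R W a (\<one> \<ominus> a) u u"
    unfolding left_translation_def shear_def carrier_Q_loop
  proof (rule restrict_ext, clarify)
    fix x y assume xy: "x \<in> W" "y \<in> carrier R"
    have x: "x \<in> carrier R" using xy W.mem_carrier by auto
    have "a \<oplus> x = x \<oplus> a" using a x by algebra
    moreover have "u \<otimes> (\<one> \<oplus> x) \<oplus> y \<otimes> (\<one> \<ominus> a) = (\<one> \<ominus> a) \<otimes> y \<oplus> u \<otimes> x \<oplus> u"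
      using a x xy z by algebra
    ultimately show "z \<otimes>\<^bsub>Q_loop R W\<^esub> (x, y) = (x \<oplus> a, (\<one> \<ominus> a) \<otimes> y \<oplus> u \<otimes> x \<oplus> u)"
      by (simp add: z)
  qed
  thus "left_translation (Q_loop R W) z \<in> shears R W"
    unfolding shears_def using a z ne by blast
  have "right_translation (Q_loop R W) z = shear R W a (\<one> \<oplus> a) (\<ominus> u) u"
    unfolding right_translation_def shear_def carrier_Q_loop
  proof (rule restrict_ext, clarify)
    fix x y assume xy: "x \<in> W" "y \<in> carrier R"
    have x: "x \<in> carrier R" using xy W.mem_carrier by auto
    have "y \<otimes> (\<one> \<oplus> a) \<oplus> u \<otimes> (\<one> \<ominus> x) = (\<one> \<oplus> a) \<otimes> y \<oplus> (\<ominus> u) \<otimes> x \<oplus> u"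
      using a x xy z by algebra
    thus "(x, y) \<otimes>\<^bsub>Q_loop R W\<^esub> z = (x \<oplus> a, (\<one> \<oplus> a) \<otimes> y \<oplus> (\<ominus> u) \<otimes> x \<oplus> u)"
      by (simp add: z)
  qed
  thus "right_translation (Q_loop R W) z \<in> shears R W"
    unfolding shears_def using a z ne by blast
qed

text \<open>Such a shear is \<open>(x, y) \<mapsto> (x, \<alpha>y + \<beta>x)\<close>. In the product of the images of \<open>(a, u)\<close> and
  \<open>(b, v)\<close> the terms \<open>\<beta>ab\<close> and \<open>-\<beta>ba\<close> cancel, which leaves \<open>\<beta>(a + b)\<close>.\<close>

lemma shear_fixing_one_auto:
  assumes W: "subgroup W (add_monoid R)" and f: "f \<in> shears R W" and f0: "f (\<zero>, \<zero>) = (\<zero>, \<zero>)"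
  shows "f \<in> auto (Q_loop R W)"
proof -
  interpret W: subgroup W "add_monoid R" by (rule W)
  from f obtain c \<alpha> \<beta> \<gamma> where
      fc: "f = shear R W c \<alpha> \<beta> \<gamma>" "c \<in> W" "\<alpha> \<in> carrier R" "\<beta> \<in> carrier R" "\<gamma> \<in> carrier R"
    by (auto simp: shears_def)
  have "\<zero> \<in> W" using W.one_closed by simp
  hence c0: "c = \<zero>" "\<gamma> = \<zero>" using f0 fc W.mem_carrier by auto
  have app: "f (x, y) = (x, \<alpha> \<otimes> y \<oplus> \<beta> \<otimes> x)" if "x \<in> W" "y \<in> carrier R" for x y
    using that fc W.mem_carrier by (simp add: c0)
  have "f \<in> hom (Q_loop R W) (Q_loop R W)"
  proof (rule homI)
    fix z assume "z \<in> carrier (Q_loop R W)"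
    thus "f z \<in> carrier (Q_loop R W)" using shear_closed[OF W f] by simp
  next
    fix z z' assume "z \<in> carrier (Q_loop R W)" "z' \<in> carrier (Q_loop R W)"
    then obtain a u b v where z: "z = (a, u)" "z' = (b, v)" and
      s: "a \<in> W" "b \<in> W" "u \<in> carrier R" "v \<in> carrier R" by auto
    have ab: "a \<in> carrier R" "b \<in> carrier R" "a \<oplus> b \<in> W"
      using s W.mem_carrier W.m_closed by auto
    have "\<alpha> \<otimes> (u \<otimes> (\<one> \<oplus> b) \<oplus> v \<otimes> (\<one> \<ominus> a)) \<oplus> \<beta> \<otimes> (a \<oplus> b)
      = (\<alpha> \<otimes> u \<oplus> \<beta> \<otimes> a) \<otimes> (\<one> \<oplus> b) \<oplus> (\<alpha> \<otimes> v \<oplus> \<beta> \<otimes> b) \<otimes> (\<one> \<ominus> a)"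
      using s ab fc by algebra
    thus "f (z \<otimes>\<^bsub>Q_loop R W\<^esub> z') = f z \<otimes>\<^bsub>Q_loop R W\<^esub> f z'"
      using s ab by (simp add: z app)
  qed
  thus ?thesis using shears_in_Bij[OF W f] by (simp add: auto_def)
qed

text \<open>All inner mappings are shears that fix the identity element. The translations are bijective
  because shears are.\<close>

theorem Q_loop_automorphic:
  assumes W: "subgroup W (add_monoid R)" and 1: "\<one> \<notin> W"
  shows "automorphic_loop (Q_loop R W)"
proof -
  interpret W: subgroup W "add_monoid R" by (rule W)
  let ?Q = "Q_loop R W"
  interpret B: group "BijGroup (W \<times> carrier R)" by (rule group_BijGroup)
  have bij: "bij_betw f (W \<times> carrier R) (W \<times> carrier R)" if "f \<in> shears R W" for f
    using shears_in_Bij[OF W that] by (simp add: Bij_def)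
  have Mlt: "multiplication_group ?Q \<subseteq> shears R W"
    unfolding multiplication_group_def carrier_Q_loop
    using Q_loop_translations_in_shears[OF W 1]
    by (intro B.generate_subgroup_incl shears_subgroup[OF W]) blast
  show ?thesis
  proof
    fix z z' assume "z \<in> carrier ?Q" "z' \<in> carrier ?Q"
    then obtain a u b v where z: "z = (a, u)" "z' = (b, v)" and
      s: "a \<in> W" "b \<in> W" "u \<in> carrier R" "v \<in> carrier R" by auto
    thus "z \<otimes>\<^bsub>?Q\<^esub> z' \<in> carrier ?Q" by (simp add: W.mem_carrier[simplified] W.m_closed[simplified])
  next
    show "\<one>\<^bsub>?Q\<^esub> \<in> carrier ?Q" using W.one_closed by simp
  next
    fix z assume "z \<in> carrier ?Q"
    then obtain a u where z: "z = (a, u)" "a \<in> W" "a \<in> carrier R" "u \<in> carrier R"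
      using W.mem_carrier by auto
    thus "\<one>\<^bsub>?Q\<^esub> \<otimes>\<^bsub>?Q\<^esub> z = z" "z \<otimes>\<^bsub>?Q\<^esub> \<one>\<^bsub>?Q\<^esub> = z"
      by (simp_all add: minus_eq)
  next
    fix x assume x: "x \<in> carrier ?Q"
    have "bij_betw (left_translation ?Q x) (carrier ?Q) (carrier ?Q)"
      using bij Q_loop_translations_in_shears(1)[OF W 1] x by simp
    thus "bij_betw (\<lambda>y. x \<otimes>\<^bsub>?Q\<^esub> y) (carrier ?Q) (carrier ?Q)"
      by (rule bij_betw_cong[THEN iffD1, rotated]) (simp add: left_translation_def)
    have "bij_betw (right_translation ?Q x) (carrier ?Q) (carrier ?Q)"
      using bij Q_loop_translations_in_shears(2)[OF W 1] x by simp
    thus "bij_betw (\<lambda>y. y \<otimes>\<^bsub>?Q\<^esub> x) (carrier ?Q) (carrier ?Q)"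
      by (rule bij_betw_cong[THEN iffD1, rotated]) (simp add: right_translation_def)
  next
    fix f assume "f \<in> multiplication_group ?Q" "f \<one>\<^bsub>?Q\<^esub> = \<one>\<^bsub>?Q\<^esub>"
    thus "f \<in> auto ?Q" using Mlt shear_fixing_one_auto[OF W] by auto
  qed
qed

section \<open>Isomorphisms between the loops of a field\<close>

lemma Q_loop_ring_iso_image:
  assumes h: "h \<in> ring_iso R R" and W: "W \<subseteq> carrier R"
  shows "Q_loop R W \<cong> Q_loop R (h ` W)"
proof (rule is_isoI)
  interpret h: ring_hom_ring R R h
    using h is_ring by (auto simp: ring_iso_def intro: ring_hom_ringI2)
  have bij: "bij_betw h (carrier R) (carrier R)" using h by (simp add: ring_iso_def)
  show "map_prod h h \<in> iso (Q_loop R W) (Q_loop R (h ` W))"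
    unfolding iso_def mem_Collect_eq
  proof
    show "map_prod h h \<in> hom (Q_loop R W) (Q_loop R (h ` W))"
    proof (rule homI)
      fix z z' assume "z \<in> carrier (Q_loop R W)" "z' \<in> carrier (Q_loop R W)"
      then obtain a u b v where "z = (a, u)" "z' = (b, v)"
        "a \<in> W" "b \<in> W" "u \<in> carrier R" "v \<in> carrier R" by auto
      moreover from this have "a \<in> carrier R" "b \<in> carrier R" using W by auto
      ultimately show "map_prod h h (z \<otimes>\<^bsub>Q_loop R W\<^esub> z') = map_prod h h z \<otimes>\<^bsub>Q_loop R (h ` W)\<^esub> map_prod h h z'"
        by (simp add: minus_eq)
    qed auto
    have "bij_betw h W (h ` W)"
      by (rule bij_betw_subset[OF bij W]) simp
    thus "bij_betw (map_prod h h) (carrier (Q_loop R W)) (carrier (Q_loop R (h ` W)))"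
      using bij unfolding carrier_Q_loop by (rule bij_betw_map_prod)
  qed
qed

lemma add_self_cancel:
  assumes "\<one> \<oplus> \<one> \<noteq> \<zero>" "x \<in> carrier R" "y \<in> carrier R" "x \<oplus> x = y \<oplus> y"
  shows "x = y"
proof -
  have "(\<one> \<oplus> \<one>) \<otimes> x = (\<one> \<oplus> \<one>) \<otimes> y"
    using assms(2-) by (simp add: l_distr)
  thus ?thesis using assms by (simp add: m_lcancel)
qed

text \<open>Suppose that \<open>(0, u)\<close> is mapped to \<open>(a, z)\<close> with \<open>a \<noteq> 0\<close>. Then \<open>(a, z)\<close> commutes only with
  those \<open>(b, y)\<close> for which \<open>2zb = 2ay\<close>, and there \<open>y\<close> is determined by \<open>b \<in> W'\<close>. But \<open>(0, u)\<close>
  commutes with all \<open>(0, v)\<close>, so \<open>card K \<le> card W'\<close>, contradicting \<open>1 \<notin> W'\<close>.\<close>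

lemma Q_loop_iso_preserves_fibre:
  assumes fin: "finite (carrier R)" and two: "\<one> \<oplus> \<one> \<noteq> \<zero>"
    and W: "subgroup W (add_monoid R)"
    and W': "subgroup W' (add_monoid R)" "\<one> \<notin> W'"
    and \<phi>: "\<phi> \<in> iso (Q_loop R W) (Q_loop R W')" and u: "u \<in> carrier R"
  shows "fst (\<phi> (\<zero>, u)) = \<zero>"
proof (rule ccontr)
  interpret W: subgroup W "add_monoid R" by (rule W)
  interpret W': subgroup W' "add_monoid R" by (rule W'(1))
  have hom: "\<phi> \<in> hom (Q_loop R W) (Q_loop R W')" and inj: "inj_on \<phi> (W \<times> carrier R)"
    using \<phi> by (auto simp: iso_def bij_betw_def)
  have 0: "\<zero> \<in> W" using W.one_closed by simp
  have cl: "\<phi> (\<zero>, v) \<in> W' \<times> carrier R" if "v \<in> carrier R" for v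
    using hom_in_carrier[OF hom, of "(\<zero>, v)"] that 0 by simp
  obtain a z where az: "\<phi> (\<zero>, u) = (a, z)" "a \<in> W'" "a \<in> carrier R" "z \<in> carrier R"
    using cl[OF u] W'.mem_carrier by auto
  assume "fst (\<phi> (\<zero>, u)) \<noteq> \<zero>"
  hence a0: "a \<noteq> \<zero>" by (simp add: az)
  have comm: "z \<otimes> fst (\<phi> (\<zero>, v)) = a \<otimes> snd (\<phi> (\<zero>, v))" if v: "v \<in> carrier R" for v
  proof -
    obtain b y where b: "\<phi> (\<zero>, v) = (b, y)" "b \<in> W'" "b \<in> carrier R" "y \<in> carrier R"
      using cl[OF v] W'.mem_carrier by auto
    have "(\<zero>, u) \<otimes>\<^bsub>Q_loop R W\<^esub> (\<zero>, v) = (\<zero>, v) \<otimes>\<^bsub>Q_loop R W\<^esub> (\<zero>, u)"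
      using u v by (simp add: minus_eq a_comm)
    hence "(a, z) \<otimes>\<^bsub>Q_loop R W'\<^esub> (b, y) = (b, y) \<otimes>\<^bsub>Q_loop R W'\<^esub> (a, z)"
      using hom_mult[OF hom, of "(\<zero>, u)" "(\<zero>, v)"] hom_mult[OF hom, of "(\<zero>, v)" "(\<zero>, u)"]
      using u v 0 by (simp add: az b)
    hence eq: "z \<otimes> (\<one> \<oplus> b) \<oplus> y \<otimes> (\<one> \<ominus> a) = y \<otimes> (\<one> \<oplus> a) \<oplus> z \<otimes> (\<one> \<ominus> b)"
      by simp
    \<comment> \<open>The bracket is the left-hand side of \<open>eq\<close>, so that \<open>eq\<close> can be used for rewriting.\<close>
    have "z \<otimes> b \<oplus> z \<otimes> b = (z \<otimes> (\<one> \<oplus> b) \<oplus> y \<otimes> (\<one> \<ominus> a)) \<ominus> z \<ominus> y \<oplus> y \<otimes> a \<oplus> z \<otimes> b"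
      using az(3,4) b(3,4) by algebra
    also have "\<dots> = a \<otimes> y \<oplus> a \<otimes> y"
      unfolding eq using az(3,4) b(3,4) by algebra
    finally have "z \<otimes> b = a \<otimes> y" by (rule add_self_cancel[OF two, rotated 2]) (use az b in simp_all)
    thus ?thesis by (simp add: b)
  qed
  have "inj_on (\<lambda>v. fst (\<phi> (\<zero>, v))) (carrier R)"
  proof (rule inj_onI)
    fix v w assume vw: "v \<in> carrier R" "w \<in> carrier R" and eq: "fst (\<phi> (\<zero>, v)) = fst (\<phi> (\<zero>, w))"
    have "a \<otimes> snd (\<phi> (\<zero>, v)) = a \<otimes> snd (\<phi> (\<zero>, w))"
      unfolding comm[OF vw(1), symmetric] comm[OF vw(2), symmetric] eq ..
    hence "snd (\<phi> (\<zero>, v)) = snd (\<phi> (\<zero>, w))"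
      using m_lcancel[OF a0 az(3), of "snd (\<phi> (\<zero>, v))" "snd (\<phi> (\<zero>, w))"] cl[OF vw(1)] cl[OF vw(2)]
      by (simp add: mem_Times_iff)
    hence "\<phi> (\<zero>, v) = \<phi> (\<zero>, w)" using eq by (simp add: prod_eq_iff)
    thus "v = w" using inj vw 0 by (auto dest: inj_onD)
  qed
  moreover have "(\<lambda>v. fst (\<phi> (\<zero>, v))) ` carrier R \<subseteq> W'" using cl by (auto simp: mem_Times_iff)
  moreover have W'c: "W' \<subset> carrier R" using W'.subset W'(2) one_closed by auto
  moreover have "finite W'" using W'c fin finite_subset by blast
  ultimately have "card (carrier R) \<le> card W'" by (intro card_inj_on_le)
  thus False using psubset_card_mono[OF fin W'c] by simp
qed

text \<open>The map \<open>f\<close> is induced on the first coordinates, and \<open>g\<close> is the restriction to the fibre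
  \<open>0 \<times> K\<close>. For \<open>a \<in> W\<close> and \<open>u \<in> K\<close>, the relation
  \<open>(a, 0)(0, u(1 + a)) = (0, u(1 - a))(a, 0)\<close> is mapped to
  \<open>(g(u) + g(ua))(1 - f(a)) = (g(u) - g(ua))(1 + f(a))\<close>, that is,
  \<open>2g(ua) = 2g(u)f(a)\<close>.\<close>

lemma Q_loop_iso_semilinear:
  assumes fin: "finite (carrier R)" and two: "\<one> \<oplus> \<one> \<noteq> \<zero>"
    and W: "subgroup W (add_monoid R)"
    and W': "subgroup W' (add_monoid R)" "\<one> \<notin> W'"
    and iso: "Q_loop R W \<cong> Q_loop R W'"
  obtains f g where "f \<in> W \<rightarrow> W'" "g \<in> hom (add_monoid R) (add_monoid R)" "inj_on g (carrier R)"
    "\<And>a u. a \<in> W \<Longrightarrow> u \<in> carrier R \<Longrightarrow> g (u \<otimes> a) = g u \<otimes> f a"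
proof -
  interpret W: subgroup W "add_monoid R" by (rule W)
  interpret W': subgroup W' "add_monoid R" by (rule W'(1))
  obtain \<phi> where \<phi>: "\<phi> \<in> iso (Q_loop R W) (Q_loop R W')"
    using iso by (auto simp: is_iso_def)
  have hom: "\<phi> \<in> hom (Q_loop R W) (Q_loop R W')" and inj: "inj_on \<phi> (W \<times> carrier R)"
    using \<phi> by (auto simp: iso_def bij_betw_def)
  have 0: "\<zero> \<in> W" using W.one_closed by simp
  have cl: "\<phi> z \<in> W' \<times> carrier R" if "z \<in> W \<times> carrier R" for z
    using hom_in_carrier[OF hom, of z] that by simp
  have mult: "\<phi> (z \<otimes>\<^bsub>Q_loop R W\<^esub> z') = \<phi> z \<otimes>\<^bsub>Q_loop R W'\<^esub> \<phi> z'"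
    if "z \<in> W \<times> carrier R" "z' \<in> W \<times> carrier R" for z z'
    using hom_mult[OF hom] that by simp
  define f where "f = (\<lambda>a. fst (\<phi> (a, \<zero>)))"
  define g where "g = (\<lambda>u. snd (\<phi> (\<zero>, u)))"
  have g: "\<phi> (\<zero>, u) = (\<zero>, g u)" "g u \<in> carrier R" if "u \<in> carrier R" for u
    using Q_loop_iso_preserves_fibre[OF fin two W W' \<phi> that] cl[of "(\<zero>, u)"] that 0
    by (auto simp: g_def prod_eq_iff mem_Times_iff)
  have g_add: "g (u \<oplus> v) = g u \<oplus> g v" if "u \<in> carrier R" "v \<in> carrier R" for u v
    using mult[of "(\<zero>, u)" "(\<zero>, v)"] that 0 g by (simp add: minus_eq)
  have f_cl: "f a \<in> W'" if "a \<in> W" for a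
    using cl[of "(a, \<zero>)"] that by (auto simp: f_def)
  show ?thesis
  proof
    show "f \<in> W \<rightarrow> W'" using f_cl by simp
    show "g \<in> hom (add_monoid R) (add_monoid R)"
      using g g_add by (intro homI) simp_all
    show "inj_on g (carrier R)"
    proof (rule inj_onI)
      fix u v assume uv: "u \<in> carrier R" "v \<in> carrier R" "g u = g v"
      hence "\<phi> (\<zero>, u) = \<phi> (\<zero>, v)" using g by simp
      thus "u = v" using inj uv 0 by (auto dest: inj_onD)
    qed
    fix a u assume a: "a \<in> W" and u: "u \<in> carrier R"
    have ac: "a \<in> carrier R" using a W.mem_carrier by simp
    have fc: "f a \<in> carrier R" using f_cl[OF a] W'.mem_carrier by simp
    obtain h where h: "\<phi> (a, \<zero>) = (f a, h)" "h \<in> carrier R"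
      using cl[of "(a, \<zero>)"] a by (auto simp: f_def)
    define U V where "U = g u" and "V = g (u \<otimes> a)"
    have UV: "U \<in> carrier R" "V \<in> carrier R" using g u ac by (auto simp: U_def V_def)
    have sum: "g (u \<otimes> (\<one> \<oplus> a)) = U \<oplus> V"
      using g_add[of u "u \<otimes> a"] u ac by (simp add: r_distr U_def V_def)
    have "g (u \<otimes> (\<one> \<ominus> a)) \<oplus> V = g (u \<otimes> (\<one> \<ominus> a) \<oplus> u \<otimes> a)"
      using g_add[of "u \<otimes> (\<one> \<ominus> a)" "u \<otimes> a"] u ac by (simp add: V_def)
    also have "u \<otimes> (\<one> \<ominus> a) \<oplus> u \<otimes> a = u" using u ac by algebra
    finally have diff: "U = g (u \<otimes> (\<one> \<ominus> a)) \<oplus> V" by (simp add: U_def)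
    have gd: "g (u \<otimes> (\<one> \<ominus> a)) \<in> carrier R" using g u ac by simp
    have diff': "g (u \<otimes> (\<one> \<ominus> a)) = U \<ominus> V" unfolding diff using gd UV by algebra
    have "u \<otimes> (\<one> \<oplus> a) \<otimes> (\<one> \<ominus> a) = u \<otimes> (\<one> \<ominus> a) \<otimes> (\<one> \<oplus> a)" using u ac by algebra
    hence "(a, \<zero>) \<otimes>\<^bsub>Q_loop R W\<^esub> (\<zero>, u \<otimes> (\<one> \<oplus> a)) = (\<zero>, u \<otimes> (\<one> \<ominus> a)) \<otimes>\<^bsub>Q_loop R W\<^esub> (a, \<zero>)"
      using u ac by (simp add: minus_eq)
    hence "(f a, h) \<otimes>\<^bsub>Q_loop R W'\<^esub> (\<zero>, U \<oplus> V) = (\<zero>, U \<ominus> V) \<otimes>\<^bsub>Q_loop R W'\<^esub> (f a, h)"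
      using mult[of "(a, \<zero>)" "(\<zero>, u \<otimes> (\<one> \<oplus> a))"] mult[of "(\<zero>, u \<otimes> (\<one> \<ominus> a))" "(a, \<zero>)"]
      using a ac u 0 h(1) g(1)[of "u \<otimes> (\<one> \<oplus> a)"] g(1)[of "u \<otimes> (\<one> \<ominus> a)"] sum diff' by simp
    hence eq: "h \<otimes> (\<one> \<oplus> \<zero>) \<oplus> (U \<oplus> V) \<otimes> (\<one> \<ominus> f a) = (U \<ominus> V) \<otimes> (\<one> \<oplus> f a) \<oplus> h \<otimes> (\<one> \<ominus> \<zero>)"
      by simp
    \<comment> \<open>Again the bracket is the left-hand side of \<open>eq\<close>.\<close>
    have "V \<oplus> V = (h \<otimes> (\<one> \<oplus> \<zero>) \<oplus> (U \<oplus> V) \<otimes> (\<one> \<ominus> f a)) \<ominus> h \<ominus> (U \<ominus> V) \<oplus> (U \<oplus> V) \<otimes> f a"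
      using UV h fc by algebra
    also have "\<dots> = U \<otimes> f a \<oplus> U \<otimes> f a"
      unfolding eq using UV h fc by algebra
    finally have "V = U \<otimes> f a" by (rule add_self_cancel[OF two, rotated 2]) (use UV fc in simp_all)
    thus "g (u \<otimes> a) = g u \<otimes> f a" by (simp add: U_def V_def)
  qed
qed

text \<open>Apply \<open>g\<close> to \<open>e\<^sup>2 + n = te\<close>. This gives \<open>g(1)(e'\<^sup>2 + n) = g(1)te'\<close>, and \<open>g(1) \<noteq> 0\<close> by
  injectivity, so \<open>e'\<close> is a root of \<open>X\<^sup>2 - tX + n = (X - e)(X - (t - e))\<close>.\<close>

lemma semilinear_quadratic_root:
  assumes g: "g \<in> hom (add_monoid R) (add_monoid R)" "inj_on g (carrier R)"
    and e: "e \<in> carrier R" "e' \<in> carrier R" "\<And>u. u \<in> carrier R \<Longrightarrow> g (u \<otimes> e) = g u \<otimes> e'"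
    and t: "t \<in> carrier R" "\<And>u. u \<in> carrier R \<Longrightarrow> g (t \<otimes> u) = t \<otimes> g u"
    and n: "n \<in> carrier R" "\<And>u. u \<in> carrier R \<Longrightarrow> g (n \<otimes> u) = n \<otimes> g u"
    and quad: "e \<otimes> e \<oplus> n = t \<otimes> e"
  shows "e' = e \<or> e' = t \<ominus> e"
proof -
  interpret g: group_hom "add_monoid R" "add_monoid R" g
    by (intro group_hom.intro group_hom_axioms.intro add.group_axioms g(1))
  define y where "y = g \<one>"
  have y: "y \<in> carrier R" using g.hom_closed by (simp add: y_def)
  have "y \<noteq> \<zero>"
  proof
    assume "y = \<zero>"
    hence "g \<one> = g \<zero>" using g.hom_one by (simp add: y_def)
    thus False using inj_onD[OF g(2)] by fastforce
  qed
  have ge: "g e = y \<otimes> e'" using e(3)[of \<one>] e by (simp add: y_def)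
  have "g (e \<otimes> e) \<oplus> g n = g (t \<otimes> e)"
    using g.hom_mult[of "e \<otimes> e" n] e n by (simp add: quad)
  moreover have "g n = n \<otimes> y" using n(2)[of \<one>] n(1) by (simp add: y_def)
  ultimately have eq: "y \<otimes> e' \<otimes> e' \<oplus> n \<otimes> y = t \<otimes> (y \<otimes> e')"
    using e(3)[of e] e(1,2) t(2)[of e] by (simp add: ge)
  have "y \<otimes> (e' \<otimes> e' \<oplus> n) = y \<otimes> e' \<otimes> e' \<oplus> n \<otimes> y" using y e n(1) by algebra
  also have "\<dots> = y \<otimes> (t \<otimes> e')" unfolding eq using y e t(1) by algebra
  finally have "e' \<otimes> e' \<oplus> n = t \<otimes> e'" using y \<open>y \<noteq> \<zero>\<close> e n(1) t(1) by (simp add: m_lcancel)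
  moreover have "(e' \<ominus> e) \<otimes> (e' \<ominus> (t \<ominus> e)) = ((e' \<otimes> e' \<oplus> n) \<ominus> t \<otimes> e') \<ominus> ((e \<otimes> e \<oplus> n) \<ominus> t \<otimes> e)"
    using e(1,2) n(1) t(1) by algebra
  moreover have "t \<otimes> e' \<ominus> t \<otimes> e' \<ominus> (t \<otimes> e \<ominus> t \<otimes> e) = \<zero>" using e(1,2) t(1) by algebra
  ultimately have "(e' \<ominus> e) \<otimes> (e' \<ominus> (t \<ominus> e)) = \<zero>" by (simp add: quad)
  hence "e' \<ominus> e = \<zero> \<or> e' \<ominus> (t \<ominus> e) = \<zero>" using integral[of "e' \<ominus> e" "e' \<ominus> (t \<ominus> e)"] e(1,2) t(1) by blast
  thus ?thesis using e(1,2) t(1) by (simp only: r_right_minus_eq minus_closed)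
qed

end

section \<open>The field with \<open>p\<^sup>2\<close> elements over its prime field\<close>

locale prime_square_field = field +
  fixes k :: "'a set" and p :: nat
  assumes prime_p: "Factorial_Ring.prime p"
    and card_field: "card (carrier R) = p ^ 2"
    and subfield_k: "subfield k R"
    and card_k: "card k = p"
begin

lemma k_in_carrier [simp]: "x \<in> k \<Longrightarrow> x \<in> carrier R"
  using subfieldE(3)[OF subfield_k] by blast

lemma k_closed [simp]:
  "\<zero> \<in> k" "\<one> \<in> k" "x \<in> k \<Longrightarrow> y \<in> k \<Longrightarrow> x \<oplus> y \<in> k" "x \<in> k \<Longrightarrow> y \<in> k \<Longrightarrow> x \<otimes> y \<in> k"
  "x \<in> k \<Longrightarrow> \<ominus> x \<in> k" "x \<in> k \<Longrightarrow> y \<in> k \<Longrightarrow> x \<ominus> y \<in> k"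
  using subringE[OF subfieldE(1)[OF subfield_k]] by (auto simp: minus_eq)

lemma k_inv [simp]:
  assumes "x \<in> k" "x \<noteq> \<zero>" shows "inv x \<in> k" "x \<otimes> inv x = \<one>" "inv x \<otimes> x = \<one>"
  using subfield_m_inv[OF subfield_k, of x] assms by auto

lemma k_mult_cancel:
  assumes "x \<in> k" "x \<noteq> \<zero>" "y \<in> carrier R" "x \<otimes> y \<in> k" shows "y \<in> k"
proof -
  have "inv x \<otimes> (x \<otimes> y) = y" using assms by (simp flip: m_assoc)
  thus ?thesis using assms k_inv(1) k_closed(4) by metis
qed

lemma p_gt_1: "p > 1" using prime_p prime_gt_1_nat by blast

lemma finite_carrier: "finite (carrier R)"
  using card_field p_gt_1 by (intro card_ge_0_finite) simp

lemma finite_k: "finite k"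
  using card_k p_gt_1 by (intro card_ge_0_finite) simp

text \<open>The additive order of \<open>1\<close> divides the order \<open>p\<close> of the group \<open>(k, +)\<close> and is not \<open>1\<close>.\<close>

lemma nat_one_eq_zero_iff: "[n] \<cdot> \<one> = \<zero> \<longleftrightarrow> p dvd n"
proof -
  interpret k: subring k R by (rule subfieldE(1)[OF subfield_k])
  have "group (add_monoid (R\<lparr>carrier := k\<rparr>))"
    using abelian_group.a_group[of "R\<lparr>carrier := k\<rparr>"] ring.is_abelian_group subring_is_ring[OF k.subring_axioms] by blast
  hence "\<one> [^]\<^bsub>add_monoid (R\<lparr>carrier := k\<rparr>)\<^esub> order (add_monoid (R\<lparr>carrier := k\<rparr>)) = \<one>\<^bsub>add_monoid (R\<lparr>carrier := k\<rparr>)\<^esub>"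
    by (rule group.pow_order_eq_1) simp
  hence "\<one> [^]\<^bsub>add_monoid R\<^esub> p = \<one>\<^bsub>add_monoid R\<^esub>"
    by (simp add: order_def card_k nat_pow_def)
  hence "group.ord (add_monoid R) \<one> dvd p" using add.pow_eq_id[of \<one> p] by (simp add: add_pow_def)
  moreover have "group.ord (add_monoid R) \<one> \<noteq> 1" using add.ord_eq_1[of \<one>] by simp
  ultimately have "group.ord (add_monoid R) \<one> = p" using prime_p by (auto simp: prime_nat_iff)
  thus ?thesis using add.pow_eq_id[of \<one> n] by (simp add: add_pow_def)
qed

lemma nat_one_in_k [simp]: "[(n::nat)] \<cdot> \<one> \<in> k"
proof (induction n)
  case (Suc n)
  have "[(Suc n)] \<cdot> \<one> = [n] \<cdot> \<one> \<oplus> \<one>" by (rule add.nat_pow_Suc)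
  thus ?case using Suc by simp
qed simp

lemma nat_one_add: "[(m + n)] \<cdot> \<one> = [(m::nat)] \<cdot> \<one> \<oplus> [(n::nat)] \<cdot> \<one>"
  by (simp add: add.nat_pow_mult)

lemma nat_one_eq_iff:
  assumes "m \<le> n"
  shows "[(m::nat)] \<cdot> \<one> = [n] \<cdot> \<one> \<longleftrightarrow> p dvd n - m"
proof -
  have "[n] \<cdot> \<one> = [m] \<cdot> \<one> \<oplus> [(n - m)] \<cdot> \<one>" using assms by (simp flip: nat_one_add)
  moreover have "[m] \<cdot> \<one> = [m] \<cdot> \<one> \<oplus> [(n - m)] \<cdot> \<one> \<longleftrightarrow> [(n - m)] \<cdot> \<one> = \<zero>"
    using add.r_cancel_one'[of "[m] \<cdot> \<one>" "[(n - m)] \<cdot> \<one>"] by simp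
  ultimately show ?thesis using nat_one_eq_zero_iff by metis
qed

text \<open>The first \<open>p\<close> multiples of \<open>1\<close> are distinct and lie in \<open>k\<close>, so they exhaust it.\<close>

lemma k_eq: "k = (\<lambda>n. [n] \<cdot> \<one>) ` {..<p}"
proof -
  have "inj_on (\<lambda>n::nat. [n] \<cdot> \<one>) {..<p}"
  proof (rule linorder_inj_onI')
    fix m n :: nat assume "n \<in> {..<p}" "m < n"
    hence "\<not> p dvd n - m" using nat_dvd_not_less[of "n - m" p] by simp
    thus "[m] \<cdot> \<one> \<noteq> [n] \<cdot> \<one>" using nat_one_eq_iff[of m n] \<open>m < n\<close> by simp
  qed
  hence "card ((\<lambda>n::nat. [n] \<cdot> \<one>) ` {..<p}) = card k" by (simp add: card_image card_k)
  thus ?thesis using finite_k by (intro card_subset_eq[symmetric]) auto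
qed

text \<open>Multiplication by \<open>c \<in> k\<close> is repeated addition because \<open>k\<close> is the prime field.\<close>

lemma additive_imp_k_linear:
  assumes g: "g \<in> hom (add_monoid R) (add_monoid R)" and c: "c \<in> k" and u: "u \<in> carrier R"
  shows "g (c \<otimes> u) = c \<otimes> g u"
proof -
  interpret g: group_hom "add_monoid R" "add_monoid R" g
    by (intro group_hom.intro group_hom_axioms.intro add.group_axioms g(1))
  have gu: "g u \<in> carrier R" using g.hom_closed u by simp
  obtain n :: nat where "c = [n] \<cdot> \<one>" using c k_eq by auto
  thus ?thesis using g.hom_nat_pow[of u n] u gu by (simp add: add_pow_ldistr) (simp add: add_pow_def)
qed

text \<open>\<open>1\<close> and \<open>e\<close> are linearly independent over \<open>k\<close>, and \<open>k \<times> k\<close> has as many elements as \<open>K\<close>.\<close>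

lemma basis_bij:
  assumes e: "e \<in> carrier R - k"
  shows "bij_betw (\<lambda>(x, y). x \<oplus> y \<otimes> e) (k \<times> k) (carrier R)"
proof -
  have inj: "inj_on (\<lambda>(x, y). x \<oplus> y \<otimes> e) (k \<times> k)"
  proof (rule inj_onI, clarify)
    fix x y x' y' assume k: "x \<in> k" "y \<in> k" "x' \<in> k" "y' \<in> k" and eq: "x \<oplus> y \<otimes> e = x' \<oplus> y' \<otimes> e"
    have c: "x \<in> carrier R" "y \<in> carrier R" "x' \<in> carrier R" "y' \<in> carrier R" "e \<in> carrier R"
      using k e by auto
    have "(y \<ominus> y') \<otimes> e = (x \<oplus> y \<otimes> e) \<ominus> x \<ominus> y' \<otimes> e" using c by algebra
    also have "\<dots> = x' \<ominus> x" unfolding eq using c by algebra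
    finally have "(y \<ominus> y') \<otimes> e \<in> k" using k by simp
    hence "y \<ominus> y' = \<zero>" using k_mult_cancel[of "y \<ominus> y'" e] k_closed(6)[OF k(2,4)] e by blast
    hence y: "y = y'" using k by (simp add: r_right_minus_eq)
    have "x = (x \<oplus> y \<otimes> e) \<ominus> y \<otimes> e" using c by algebra
    also have "\<dots> = x'" unfolding eq unfolding y using c by algebra
    finally show "x = x' \<and> y = y'" using y by simp
  qed
  moreover have "(\<lambda>(x, y). x \<oplus> y \<otimes> e) ` (k \<times> k) = carrier R"
  proof (rule card_subset_eq[OF finite_carrier])
    show "(\<lambda>(x, y). x \<oplus> y \<otimes> e) ` (k \<times> k) \<subseteq> carrier R" using e by auto
    show "card ((\<lambda>(x, y). x \<oplus> y \<otimes> e) ` (k \<times> k)) = card (carrier R)"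
      using card_image[OF inj] by (simp add: card_cartesian_product card_k card_field power2_eq_square)
  qed
  ultimately show ?thesis using inj by (simp add: bij_betw_def)
qed

lemma basis_unique:
  assumes "e \<in> carrier R - k" "x \<in> k" "y \<in> k" "x' \<in> k" "y' \<in> k" "x \<oplus> y \<otimes> e = x' \<oplus> y' \<otimes> e"
  shows "x = x' \<and> y = y'"
  using inj_onD[OF bij_betw_imp_inj_on[OF basis_bij[OF assms(1)]], of "(x, y)" "(x', y')"] assms(2-)
  by simp

lemma basis_exhaust:
  assumes "e \<in> carrier R - k" "z \<in> carrier R"
  obtains x y where "x \<in> k" "y \<in> k" "z = x \<oplus> y \<otimes> e"
  using bij_betw_imp_surj_on[OF basis_bij[OF assms(1)]] assms(2) by force

lemma quadratic_equation:
  assumes e: "e \<in> carrier R - k"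
  obtains t n where "t \<in> k" "n \<in> k" "e \<otimes> e \<oplus> n = t \<otimes> e"
proof -
  obtain x y where xy: "x \<in> k" "y \<in> k" "e \<otimes> e = x \<oplus> y \<otimes> e"
    using basis_exhaust[OF e, of "e \<otimes> e"] e by auto
  have "x \<in> carrier R" "y \<in> carrier R" "e \<in> carrier R" using xy e by auto
  hence "e \<otimes> e \<oplus> \<ominus> x = y \<otimes> e" unfolding xy(3) by algebra
  thus ?thesis using that[of y "\<ominus> x"] xy by simp
qed

lemma conjugate_notin_k:
  assumes "e \<in> carrier R - k" "t \<in> k" shows "t \<ominus> e \<in> carrier R - k"
proof -
  have "t \<in> carrier R" "e \<in> carrier R" using assms by auto
  hence "t \<ominus> (t \<ominus> e) = e" by algebra
  thus ?thesis using assms k_closed(6)[of t "t \<ominus> e"] by auto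
qed

text \<open>The root \<open>t - e\<close> satisfies the same quadratic equation as \<open>e\<close>, and multiplication in
  \<open>K = k + ke\<close> is determined by that equation.\<close>

lemma conjugation_ring_iso:
  assumes e: "e \<in> carrier R - k" and t: "t \<in> k" and n: "n \<in> k"
    and quad: "e \<otimes> e \<oplus> n = t \<otimes> e"
  obtains h where "h \<in> ring_iso R R" "\<And>x y. x \<in> k \<Longrightarrow> y \<in> k \<Longrightarrow> h (x \<oplus> y \<otimes> e) = x \<oplus> y \<otimes> (t \<ominus> e)"
proof -
  let ?e' = "t \<ominus> e"
  define c where "c = the_inv_into (k \<times> k) (\<lambda>(x, y). x \<oplus> y \<otimes> e)"
  define h where "h = (\<lambda>(x, y). x \<oplus> y \<otimes> ?e') \<circ> c"
  note b = basis_bij[OF e]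
  have h: "h (x \<oplus> y \<otimes> e) = x \<oplus> y \<otimes> ?e'" if "x \<in> k" "y \<in> k" for x y
    using the_inv_into_f_f[OF bij_betw_imp_inj_on[OF b], of "(x, y)"] that by (simp add: h_def c_def)
  have ec: "e \<in> carrier R" "?e' \<in> carrier R" and c: "t \<in> carrier R" "n \<in> carrier R"
    using e t n by auto
  have ee: "e \<otimes> e = t \<otimes> e \<ominus> n" unfolding quad[symmetric] using ec c by algebra
  have ee': "?e' \<otimes> ?e' = t \<otimes> ?e' \<ominus> n"
  proof -
    have "?e' \<otimes> ?e' = t \<otimes> ?e' \<ominus> t \<otimes> e \<oplus> e \<otimes> e" using ec(1) c by algebra
    also have "\<dots> = t \<otimes> ?e' \<ominus> n" unfolding ee using ec(1) c by algebra
    finally show ?thesis .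
  qed
  have "h \<in> ring_iso R R"
  proof (rule ring_iso_memI)
    fix z assume "z \<in> carrier R"
    then obtain x y where "x \<in> k" "y \<in> k" "z = x \<oplus> y \<otimes> e" by (rule basis_exhaust[OF e])
    thus "h z \<in> carrier R" using h[of x y] ec(2) by simp
  next
    fix z w assume "z \<in> carrier R" and w: "w \<in> carrier R"
    then obtain x y where xy: "x \<in> k" "y \<in> k" "z = x \<oplus> y \<otimes> e" by (blast elim: basis_exhaust[OF e])
    obtain x' y' where xy': "x' \<in> k" "y' \<in> k" "w = x' \<oplus> y' \<otimes> e"
      using w by (rule basis_exhaust[OF e])
    note k = xy(1,2) xy'(1,2) and zw = xy(3) xy'(3)
    have mul: "(x \<oplus> y \<otimes> f) \<otimes> (x' \<oplus> y' \<otimes> f) = (x \<otimes> x' \<ominus> n \<otimes> y \<otimes> y') \<oplus> (x \<otimes> y' \<oplus> y \<otimes> x' \<oplus> t \<otimes> y \<otimes> y') \<otimes> f"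
      if f: "f \<in> carrier R" and ff: "f \<otimes> f = t \<otimes> f \<ominus> n" for f
    proof -
      have "(x \<oplus> y \<otimes> f) \<otimes> (x' \<oplus> y' \<otimes> f) = x \<otimes> x' \<oplus> (x \<otimes> y' \<oplus> y \<otimes> x') \<otimes> f \<oplus> y \<otimes> y' \<otimes> (f \<otimes> f)"
        using k[THEN k_in_carrier] f by algebra
      also have "\<dots> = (x \<otimes> x' \<ominus> n \<otimes> y \<otimes> y') \<oplus> (x \<otimes> y' \<oplus> y \<otimes> x' \<oplus> t \<otimes> y \<otimes> y') \<otimes> f"
        unfolding ff using k[THEN k_in_carrier] f c by algebra
      finally show ?thesis .
    qed
    show "h (z \<otimes> w) = h z \<otimes> h w"
      unfolding zw mul[OF ec(1) ee] using k t n by (simp add: h mul[OF ec(2) ee'])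
    have add: "(x \<oplus> y \<otimes> f) \<oplus> (x' \<oplus> y' \<otimes> f) = (x \<oplus> x') \<oplus> (y \<oplus> y') \<otimes> f" if f: "f \<in> carrier R" for f
      using k[THEN k_in_carrier] f by algebra
    show "h (z \<oplus> w) = h z \<oplus> h w"
      unfolding zw add[OF ec(1)] using k by (simp add: h add[OF ec(2)])
  next
    show "h \<one> = \<one>" using h[of \<one> \<zero>] ec by simp
  next
    show "bij_betw h (carrier R) (carrier R)"
      unfolding h_def c_def
      by (rule bij_betw_trans[OF bij_betw_the_inv_into[OF b] basis_bij[OF conjugate_notin_k[OF e t]]])
  qed
  thus ?thesis using that h by blast
qed

section \<open>The loops of order \<open>p\<^sup>3\<close>\<close>

definition line :: "'a \<Rightarrow> 'a set" where "line e = {c \<otimes> e | c. c \<in> k}"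

lemma self_in_line: "e \<in> carrier R \<Longrightarrow> e \<in> line e"
  unfolding line_def using k_closed(2) l_one[of e] by (intro CollectI exI[of _ \<one>]) simp

lemma line_in_carrier: "e \<in> carrier R \<Longrightarrow> line e \<subseteq> carrier R"
  unfolding line_def by auto

lemma card_line:
  assumes e: "e \<in> carrier R - {\<zero>}" shows "card (line e) = p"
proof -
  have "inj_on (\<lambda>c. c \<otimes> e) k"
    using e m_rcancel[of e] by (intro inj_onI) auto
  moreover have "line e = (\<lambda>c. c \<otimes> e) ` k" unfolding line_def by blast
  ultimately show ?thesis by (simp add: card_image card_k)
qed

lemma line_subset_subspace:
  assumes "subalgebra k W R" "e \<in> W" shows "line e \<subseteq> W"
  unfolding line_def using subalgebra.smult_closed[OF assms(1) _ assms(2)] by auto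

lemma line_subalgebra:
  assumes e: "e \<in> carrier R" shows "subalgebra k (line e) R"
proof (rule subalgebra.intro)
  show "subgroup (line e) (add_monoid R)"
  proof (rule add.subgroupI)
    show "line e \<subseteq> carrier R" by (rule line_in_carrier[OF e])
    show "line e \<noteq> {}" using self_in_line[OF e] by blast
    show "\<ominus> x \<in> line e" if "x \<in> line e" for x
    proof -
      obtain c where "c \<in> k" "x = c \<otimes> e" using \<open>x \<in> line e\<close> by (auto simp: line_def)
      hence "\<ominus> x = (\<ominus> c) \<otimes> e" "\<ominus> c \<in> k" using e by (simp_all add: l_minus)
      thus ?thesis unfolding line_def by blast
    qed
    show "x \<oplus> y \<in> line e" if "x \<in> line e" "y \<in> line e" for x y
    proof -
      obtain c d where "c \<in> k" "x = c \<otimes> e" "d \<in> k" "y = d \<otimes> e"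
        using \<open>x \<in> line e\<close> \<open>y \<in> line e\<close> by (auto simp: line_def)
      hence "x \<oplus> y = (c \<oplus> d) \<otimes> e" "c \<oplus> d \<in> k" using e by (simp_all add: l_distr)
      thus ?thesis unfolding line_def by blast
    qed
  qed
  show "subalgebra_axioms k (line e) R"
  proof
    fix c x assume c: "c \<in> k" and "x \<in> line e"
    then obtain d where "d \<in> k" "x = d \<otimes> e" by (auto simp: line_def)
    hence "c \<otimes> x = (c \<otimes> d) \<otimes> e" "c \<otimes> d \<in> k" using c e by (simp_all add: m_assoc)
    thus "c \<otimes> x \<in> line e" unfolding line_def by blast
  qed
qed

lemma one_notin_line:
  assumes "e \<in> carrier R - k" shows "\<one> \<notin> line e"
proof
  assume "\<one> \<in> line e"
  then obtain c where c: "c \<in> k" "\<one> = c \<otimes> e" by (auto simp: line_def)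
  moreover from this have "c \<noteq> \<zero>" using assms by auto
  ultimately have "e \<in> k" using k_mult_cancel[of c e] k_closed(2) assms by (metis DiffD1)
  thus False using assms by blast
qed

lemma order_Q_loop: "order (Q_loop R W) = card W * p ^ 2"
  by (simp add: order_def card_cartesian_product card_field)

text \<open>Since the order of the loop is \<open>p\<^sup>2\<close> times the cardinality of \<open>W\<close>, order \<open>p\<^sup>3\<close> forces
  \<open>W\<close> to be a line; it meets \<open>k\<close> trivially if and only if a generator lies outside \<open>k\<close>.\<close>

lemma automorphic_Q_loops_iff:
  "Q \<in> automorphic_Q_loops R k (p ^ 3) \<longleftrightarrow> (\<exists>e \<in> carrier R - k. Q = Q_loop R (line e))"
proof
  assume "Q \<in> automorphic_Q_loops R k (p ^ 3)"
  then obtain W where Q: "Q = Q_loop R W" and W: "subalgebra k W R" "k \<inter> W = {\<zero>}"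
    and "order Q = p ^ 3" by (auto simp: automorphic_Q_loops_def admissible_subspace_def)
  hence "card W * p ^ 2 = p * p ^ 2" using order_Q_loop[of W] by (simp add: eval_nat_numeral)
  hence card: "card W = p" using p_gt_1 by simp
  have "W \<noteq> {\<zero>}" using card p_gt_1 by auto
  then obtain e where e: "e \<in> W" "e \<noteq> \<zero>" using W(2) by blast
  hence ek: "e \<in> carrier R - k" using W subalgebra_in_carrier[OF W(1)] by auto
  have "finite W" using card p_gt_1 by (intro card_ge_0_finite) simp
  moreover have "card (line e) = card W" using card card_line[of e] ek e by auto
  ultimately have "line e = W" by (intro card_subset_eq line_subset_subspace W(1) e(1))
  thus "\<exists>e \<in> carrier R - k. Q = Q_loop R (line e)" using Q ek by blast
next
  assume "\<exists>e \<in> carrier R - k. Q = Q_loop R (line e)"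
  then obtain e where e: "e \<in> carrier R - k" and Q: "Q = Q_loop R (line e)" by blast
  have e0: "e \<in> carrier R - {\<zero>}" using e k_closed(1) by blast
  have sub: "subalgebra k (line e) R" using e line_subalgebra by simp
  have meet: "k \<inter> line e = {\<zero>}"
  proof
    show "{\<zero>} \<subseteq> k \<inter> line e"
      using e by (auto simp: line_def intro!: exI[of _ \<zero>])
    show "k \<inter> line e \<subseteq> {\<zero>}"
    proof
      fix x assume "x \<in> k \<inter> line e"
      then obtain c where c: "c \<in> k" "x = c \<otimes> e" "c \<otimes> e \<in> k" by (auto simp: line_def)
      hence "c = \<zero>" using k_mult_cancel[of c e] e by blast
      thus "x \<in> {\<zero>}" using c e by simp
    qed
  qed
  have "automorphic_loop Q"
    unfolding Q using sub one_notin_line[OF e] by (intro Q_loop_automorphic) (simp_all add: subalgebra_def)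
  moreover have "order Q = p ^ 3"
    unfolding Q order_Q_loop card_line[OF e0] by (simp add: eval_nat_numeral)
  ultimately show "Q \<in> automorphic_Q_loops R k (p ^ 3)"
    using sub meet Q by (auto simp: automorphic_Q_loops_def admissible_subspace_def)
qed

text \<open>Conjugation is a field automorphism that fixes \<open>k\<close>, so it takes \<open>ke\<close> to \<open>k(t - e)\<close>.\<close>

lemma Q_loop_line_conjugate_iso:
  assumes e: "e \<in> carrier R - k" and t: "t \<in> k" and n: "n \<in> k"
    and quad: "e \<otimes> e \<oplus> n = t \<otimes> e"
  shows "Q_loop R (line e) \<cong> Q_loop R (line (t \<ominus> e))"
proof -
  obtain h where h: "h \<in> ring_iso R R" 
    and eq: "\<And>x y. x \<in> k \<Longrightarrow> y \<in> k \<Longrightarrow> h (x \<oplus> y \<otimes> e) = x \<oplus> y \<otimes> (t \<ominus> e)"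
    using conjugation_ring_iso[OF assms] by blast
  have "h (c \<otimes> e) = c \<otimes> (t \<ominus> e)" if "c \<in> k" for c
    using eq[of \<zero> c] that e t by simp
  hence "h ` line e = line (t \<ominus> e)" unfolding line_def by force
  thus ?thesis using Q_loop_ring_iso_image[OF h line_in_carrier[of e]] e by simp
qed

lemma two_ne_zero: "odd p \<Longrightarrow> \<one> \<oplus> \<one> \<noteq> \<zero>"
proof -
  assume "odd p"
  hence "\<not> p dvd 2" using prime_p by (metis dvd_refl primes_dvd_imp_eq two_is_prime_nat)
  thus ?thesis using nat_one_eq_zero_iff[of 2] nat_one_add[of 1 1] by (simp add: numeral_2_eq_2)
qed

text \<open>The line of \<open>e'\<close> is contained in that of \<open>e\<close>, and both have \<open>p\<close> elements.\<close>

lemma line_eqI: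
  assumes "e \<in> carrier R - k" "e' \<in> carrier R - k" "e' \<in> line e"
  shows "line e' = line e"
proof (rule card_subset_eq)
  have *: "x \<in> carrier R - {\<zero>}" if "x \<in> carrier R - k" for x using that k_closed(1) by blast
  show "finite (line e)"
    using finite_subset[OF line_in_carrier finite_carrier] assms by blast
  show "line e' \<subseteq> line e"
    using assms line_subset_subspace line_subalgebra by blast
  show "card (line e') = card (line e)" using card_line * assms by simp
qed

text \<open>For the converse of \<open>Q_loop_line_conjugate_iso\<close>, an isomorphism induces a map \<open>f\<close> into the second
  line for which \<open>f(e)\<close> is \<open>e\<close> or \<open>t - e\<close>, and a line is determined by any of its generators.\<close>

lemma Q_loop_line_iso_iff:
  assumes p: "odd p" and e: "e \<in> carrier R - k" and e': "e' \<in> carrier R - k"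
    and t: "t \<in> k" and n: "n \<in> k" and quad: "e \<otimes> e \<oplus> n = t \<otimes> e"
  shows "Q_loop R (line e) \<cong> Q_loop R (line e') \<longleftrightarrow> line e' = line e \<or> line e' = line (t \<ominus> e)"
proof
  assume "line e' = line e \<or> line e' = line (t \<ominus> e)"
  thus "Q_loop R (line e) \<cong> Q_loop R (line e')"
    using Q_loop_line_conjugate_iso[OF e t n quad] iso_refl by metis
next
  assume iso: "Q_loop R (line e) \<cong> Q_loop R (line e')"
  have sub: "subgroup (line x) (add_monoid R)" if "x \<in> carrier R - k" for x
    using line_subalgebra[of x] that by (simp add: subalgebra_def)
  obtain f g where fg: "f \<in> line e \<rightarrow> line e'" "g \<in> hom (add_monoid R) (add_monoid R)" "inj_on g (carrier R)"
    "\<And>a u. a \<in> line e \<Longrightarrow> u \<in> carrier R \<Longrightarrow> g (u \<otimes> a) = g u \<otimes> f a"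
    using Q_loop_iso_semilinear[OF finite_carrier two_ne_zero[OF p] sub[OF e] sub[OF e'] one_notin_line[OF e'] iso]
    by blast
  have el: "e \<in> line e" using self_in_line e by blast
  have fe: "f e \<in> line e'" using fg(1) el by blast
  hence fec: "f e \<in> carrier R" using line_in_carrier e' by blast
  have "f e = e \<or> f e = t \<ominus> e"
    by (rule semilinear_quadratic_root[OF fg(2,3) _ fec fg(4)[OF el]])
      (use e t n quad additive_imp_k_linear[OF fg(2)] in simp_all)
  thus "line e' = line e \<or> line e' = line (t \<ominus> e)"
    using fe line_eqI[OF e' e] line_eqI[OF e' conjugate_notin_k[OF e t]] by metis
qed

section \<open>Square roots and representatives modulo sign\<close>

lemma fermat_k:
  assumes d: "d \<in> k" "d \<noteq> \<zero>" shows "d [^] (p - 1) = \<one>"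
proof -
  let ?k = "R\<lparr>carrier := k\<rparr>"
  interpret F: cring ?k
    using subcring_iff[of k] subfieldE(2)[OF subfield_k] by (auto simp: subset_iff)
  have U: "Units ?k = k - {\<zero>}" using subfield.subfield_Units[OF subfield_k] .
  have "d [^]\<^bsub>?k\<^esub> card (Units ?k) = \<one>\<^bsub>?k\<^esub>"
    using F.units_power_order_eq_one[of d] finite_k d by (simp add: U)
  thus ?thesis using finite_k by (simp add: U card_k nat_pow_def)
qed

text \<open>\<open>K\<close> contains all square roots of elements of \<open>k\<close>: if \<open>\<gamma>\<close> generates the cyclic group \<open>K\<^sup>*\<close> and
  \<open>d = \<gamma>\<^sup>i\<close>, then \<open>d\<^bsup>p-1\<^esup> = 1\<close> shows that \<open>p\<^sup>2 - 1\<close> divides \<open>i(p - 1)\<close>. So \<open>i\<close> is a multiple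
  of the even number \<open>p + 1\<close>.\<close>

lemma square_root_exists:
  assumes p: "odd p" and d: "d \<in> k" shows "\<exists>s \<in> carrier R. s \<otimes> s = d"
proof (cases "d = \<zero>")
  case False
  note Multiplicative_Group.mult_of_simps [simp]
  interpret G: group "Multiplicative_Group.mult_of R"
    rewrites "([^]\<^bsub>Multiplicative_Group.mult_of R\<^esub>) = (([^]) :: _ \<Rightarrow> nat \<Rightarrow> _)" and "\<one>\<^bsub>Multiplicative_Group.mult_of R\<^esub> = \<one>"
    by (rule field_mult_group) (simp_all add: fun_eq_iff nat_pow_def)
  obtain \<gamma> where \<gamma>: "\<gamma> \<in> carrier (Multiplicative_Group.mult_of R)" "carrier (Multiplicative_Group.mult_of R) = {\<gamma> [^] i | i::nat. i \<in> UNIV}"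
    using finite_field_mult_group_has_gen[OF finite_carrier] by blast
  have fin: "finite (carrier (Multiplicative_Group.mult_of R))" using finite_carrier by simp
  have order: "order (Multiplicative_Group.mult_of R) = (p - 1) * (p + 1)"
    using finite_carrier by (simp add: order_def card_field algebra_simps power2_eq_square)
  have "order (Multiplicative_Group.mult_of R) = card ((\<lambda>i. \<gamma> [^] i) ` {0..G.ord \<gamma> - 1})"
    unfolding order_def using \<gamma>(2) G.ord_elems[OF fin \<gamma>(1)] by (simp add: setcompr_eq_image atLeast0AtMost atMost_def)
  also have "\<dots> \<le> card {0..G.ord \<gamma> - 1}" by (rule card_image_le) simp
  also have "\<dots> = G.ord \<gamma>" using G.ord_ge_1[OF fin \<gamma>(1)] by simp
  finally have ord: "G.ord \<gamma> = (p - 1) * (p + 1)"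
    using G.ord_le_group_order[OF fin \<gamma>(1)] order by simp
  have "d \<in> carrier (Multiplicative_Group.mult_of R)" using d False by simp
  then obtain i :: nat where i: "d = \<gamma> [^] i" using \<gamma>(2) by blast
  have "\<gamma> [^] (i * (p - 1)) = \<one>"
    using fermat_k[OF d False] \<gamma>(1) by (simp add: i nat_pow_pow)
  hence "(p - 1) * (p + 1) dvd i * (p - 1)" using G.pow_eq_id[OF \<gamma>(1)] ord by simp
  hence "(p - 1) * (p + 1) dvd (p - 1) * i" by (simp only: mult.commute)
  hence "p + 1 dvd i" using p_gt_1 dvd_times_left_cancel_iff[of "p - 1" "p + 1" i] by fastforce
  hence "even i" using p by (meson dvd_trans even_plus_one_iff)
  hence "\<gamma> [^] (i div 2) \<otimes> \<gamma> [^] (i div 2) = d"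
    using \<gamma>(1) by (simp add: nat_pow_mult i flip: mult_2)
  thus ?thesis using \<gamma>(1) by (intro bexI[of _ "\<gamma> [^] (i div 2)"]) auto
qed (use zero_closed in force)

text \<open>Existence: if \<open>a\<close> is the multiple \<open>m\<close> of \<open>1\<close> with \<open>(p - 1)/2 < m < p\<close>, then \<open>-a\<close> is the multiple
  \<open>p - m\<close>. Uniqueness: two numbers up to \<open>(p - 1)/2\<close> have their difference and their sum below \<open>p\<close>,
  so \<open>p\<close> divides neither unless it vanishes.\<close>

lemma half_representative:
  assumes p: "odd p" and a: "a \<in> k"
  shows "\<exists>!n. n \<le> (p - 1) div 2 \<and> (a = [n] \<cdot> \<one> \<or> a = \<ominus> ([n] \<cdot> \<one>))"
proof -
  obtain m where m: "m < p" "a = [m] \<cdot> \<one>" using a k_eq by auto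
  have neg: "[i] \<cdot> \<one> = \<ominus> ([j] \<cdot> \<one>) \<longleftrightarrow> p dvd i + j" for i j :: nat
  proof -
    have "[i] \<cdot> \<one> = \<ominus> ([j] \<cdot> \<one>) \<longleftrightarrow> [i] \<cdot> \<one> \<oplus> [j] \<cdot> \<one> = \<zero>"
      by (metis add.inv_equality add.l_inv nat_one_in_k k_in_carrier)
    thus ?thesis using nat_one_eq_zero_iff[of "i + j"] by (simp add: nat_one_add)
  qed
  have small: "i = j" if ij: "i \<le> (p - 1) div 2" "j \<le> (p - 1) div 2"
    and eq: "[i] \<cdot> \<one> = [j] \<cdot> \<one> \<or> [i] \<cdot> \<one> = \<ominus> ([j] \<cdot> \<one>)" for i j :: nat
    using eq
  proof
    assume "[i] \<cdot> \<one> = \<ominus> ([j] \<cdot> \<one>)"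
    hence "p dvd i + j" using neg by blast
    moreover have "i + j < p" using ij p_gt_1 by linarith
    ultimately have "i + j = 0" using nat_dvd_not_less by blast
    thus ?thesis by simp
  next
    assume eq: "[i] \<cdot> \<one> = [j] \<cdot> \<one>"
    have *: "u = v" if "u \<le> v" "v < p" "[u] \<cdot> \<one> = [v] \<cdot> \<one>" for u v :: nat
    proof -
      have "p dvd v - u" using nat_one_eq_iff[OF that(1)] that(3) by blast
      moreover have "v - u < p" using that by simp
      ultimately have "v - u = 0" using nat_dvd_not_less by blast
      thus ?thesis using that by simp
    qed
    have "i < p" "j < p" using ij p_gt_1 by linarith+
    thus ?thesis using *[of i j] *[of j i] eq by (metis linear)
  qed
  have "\<exists>n. n \<le> (p - 1) div 2 \<and> (a = [n] \<cdot> \<one> \<or> a = \<ominus> ([n] \<cdot> \<one>))"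
  proof (cases "m \<le> (p - 1) div 2")
    case False
    hence "p - m \<le> (p - 1) div 2" using p m by presburger
    moreover have "a = \<ominus> ([(p - m)] \<cdot> \<one>)" using neg[of m "p - m"] m by simp
    ultimately show ?thesis by blast
  qed (use m in blast)
  moreover have "i = j" if i: "i \<le> (p - 1) div 2" "a = [i] \<cdot> \<one> \<or> a = \<ominus> ([i] \<cdot> \<one>)"
    and j: "j \<le> (p - 1) div 2" "a = [j] \<cdot> \<one> \<or> a = \<ominus> ([j] \<cdot> \<one>)" for i j
  proof (rule small[OF i(1) j(1)])
    show "[i] \<cdot> \<one> = [j] \<cdot> \<one> \<or> [i] \<cdot> \<one> = \<ominus> ([j] \<cdot> \<one>)"
      using i(2) j(2) by (metis minus_minus nat_one_in_k k_in_carrier)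
  qed
  ultimately show ?thesis by blast
qed

section \<open>Classification by directions\<close>

text \<open>The generator of the line \<open>W\<^sub>a\<close>. In terms of projective coordinates \<open>(x : y)\<close> of the line
  through \<open>x + ys\<close>, the parameter \<open>a \<noteq> 0\<close> stands for \<open>(1 : a)\<close>, and \<open>a = 0\<close> for
  \<open>(0 : 1)\<close>, as \<open>(1 : 0)\<close> is the excluded line \<open>k\<close>.\<close>

definition direction :: "'a \<Rightarrow> 'a \<Rightarrow> 'a" where
  "direction s a = (if a = \<zero> then s else \<one> \<oplus> a \<otimes> s)"

lemma W_line_eq_line: "W_line R k s a = line (direction s a)"
  by (simp add: W_line_def line_def direction_def)

lemma direction_notin_k:
  assumes s: "s \<in> carrier R - k" and a: "a \<in> k" shows "direction s a \<in> carrier R - k"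
proof (cases "a = \<zero>")
  case False
  have "direction s a \<notin> k"
  proof
    assume "direction s a \<in> k"
    moreover have "a \<otimes> s = direction s a \<ominus> \<one>"
      using False s a[THEN k_in_carrier] by (simp add: direction_def) algebra
    ultimately have "a \<otimes> s \<in> k" by simp
    thus False using k_mult_cancel[OF a False] s by blast
  qed
  thus ?thesis using s a by (auto simp: direction_def)
qed (use s in \<open>simp add: direction_def\<close>)

text \<open>If \<open>direction s a = c * direction s b\<close> with \<open>c \<in> k\<close>, comparing coordinates with respect to the
  basis \<open>1, s\<close> yields \<open>c = 1\<close> and \<open>a = b\<close>.\<close>

lemma line_direction_inj:
  assumes s: "s \<in> carrier R - k" and a: "a \<in> k" and b: "b \<in> k"
    and eq: "line (direction s a) = line (direction s b)"
  shows "a = b"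
proof -
  have sc: "s \<in> carrier R" using s by blast
  have "direction s a \<in> line (direction s b)"
    using self_in_line direction_notin_k[OF s a] by (auto simp flip: eq)
  then obtain c where c: "c \<in> k" "direction s a = c \<otimes> direction s b" by (auto simp: line_def)
  \<comment> \<open>\<open>x a\<close> and \<open>y a\<close> are the coordinates of \<open>direction s a\<close> with respect to \<open>1, s\<close>.\<close>
  define x where "x = (\<lambda>a. if a = \<zero> then \<zero> else \<one>)"
  define y where "y = (\<lambda>a. if a = \<zero> then \<one> else a)"
  have xy: "direction s a = x a \<oplus> y a \<otimes> s" "x a \<in> k" "y a \<in> k" if "a \<in> k" for a
    using that sc by (auto simp: direction_def x_def y_def)
  have "x a \<oplus> y a \<otimes> s = c \<otimes> x b \<oplus> c \<otimes> y b \<otimes> s"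
    using c xy[OF a] xy[OF b] sc by (simp add: r_distr m_assoc)
  hence "x a = c \<otimes> x b \<and> y a = c \<otimes> y b"
    by (rule basis_unique[OF s, rotated 4]) (use xy[OF a] xy[OF b] c(1) in simp_all)
  thus "a = b" using a b c(1) by (auto simp: x_def y_def split: if_splits)
qed

text \<open>For \<open>e = x + ys\<close> with \<open>x \<noteq> 0\<close>, rescaling by the inverse of \<open>x\<close> gives the direction \<open>a = y/x\<close>.\<close>

lemma line_eq_line_direction:
  assumes s: "s \<in> carrier R - k" and e: "e \<in> carrier R - k"
  obtains a where "a \<in> k" "line e = line (direction s a)"
proof -
  have "e \<in> carrier R" using e by blast
  then obtain x y where xy: "x \<in> k" "y \<in> k" "e = x \<oplus> y \<otimes> s" by (rule basis_exhaust[OF s])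
  have sc: "s \<in> carrier R" using s by blast
  show ?thesis
  proof (cases "x = \<zero>")
    case True
    hence "e = y \<otimes> direction s \<zero>" using xy sc by (simp add: direction_def)
    hence "e \<in> line (direction s \<zero>)" unfolding line_def using xy(2) by blast
    thus ?thesis using that[of \<zero>] line_eqI[OF direction_notin_k[OF s] e, of \<zero>] by simp
  next
    case False
    have y0: "y \<noteq> \<zero>" using xy e sc by auto
    define a where "a = inv x \<otimes> y"
    have i: "inv x \<in> k" "x \<otimes> inv x = \<one>" using xy(1) False by simp_all
    have a: "a \<in> k" using i xy by (simp add: a_def)
    have xa: "x \<otimes> a = y" unfolding a_def using i xy by (simp flip: m_assoc)
    hence "a \<noteq> \<zero>" using y0 xy by auto
    hence "x \<otimes> direction s a = x \<oplus> (x \<otimes> a) \<otimes> s"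
      using xy a sc by (simp add: direction_def r_distr m_assoc)
    hence "e = x \<otimes> direction s a" using xy xa by simp
    hence "e \<in> line (direction s a)" unfolding line_def using xy(1) by blast
    thus ?thesis using that[OF a] line_eqI[OF direction_notin_k[OF s a] e] by simp
  qed
qed

text \<open>The conjugate of \<open>1 + as\<close> is \<open>1 - as\<close>, and the conjugate of \<open>s\<close> is \<open>-s\<close>, which spans the
  same line as \<open>s\<close>. So conjugation takes the line of \<open>a\<close> to the line of \<open>-a\<close>.\<close>

lemma Q_loop_direction_iso_iff:
  assumes p: "odd p" and s: "s \<in> carrier R - k" and ss: "s \<otimes> s \<in> k" and a: "a \<in> k" and b: "b \<in> k"
  shows "Q_loop R (line (direction s a)) \<cong> Q_loop R (line (direction s b)) \<longleftrightarrow> a = b \<or> a = \<ominus> b"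
proof -
  have c: "s \<in> carrier R" "a \<in> carrier R" "b \<in> carrier R" using s a b by auto
  let ?e = "direction s a"
  note e = direction_notin_k[OF s a] and e' = direction_notin_k[OF s b]
  have "\<exists>t n. t \<in> k \<and> n \<in> k \<and> ?e \<otimes> ?e \<oplus> n = t \<otimes> ?e \<and> line (t \<ominus> ?e) = line (direction s (\<ominus> a))"
  proof (cases "a = \<zero>")
    case True
    have "\<zero> \<ominus> s = (\<ominus> \<one>) \<otimes> s" using c by algebra
    hence "\<zero> \<ominus> s \<in> line s" unfolding line_def using k_closed(2,5) by blast
    hence "line (\<zero> \<ominus> s) = line s" using line_eqI[OF s conjugate_notin_k[OF s k_closed(1)]] by blast
    moreover have "s \<otimes> s \<oplus> \<ominus> (s \<otimes> s) = \<zero> \<otimes> s" using c by (simp add: r_neg)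
    ultimately show ?thesis
      using True ss by (intro exI[of _ \<zero>] exI[of _ "\<ominus> (s \<otimes> s)"]) (simp add: direction_def)
  next
    case False
    hence "\<ominus> a \<noteq> \<zero>" using c by (metis minus_minus minus_zero)
    \<comment> \<open>The element \<open>1 + as\<close> has trace \<open>2\<close> and norm \<open>1 - a\<^sup>2s\<^sup>2\<close>.\<close>
    hence "\<one> \<oplus> \<one> \<ominus> ?e = direction s (\<ominus> a)"
      using False c by (simp add: direction_def) algebra
    moreover have "?e \<otimes> ?e \<oplus> (\<one> \<ominus> a \<otimes> a \<otimes> (s \<otimes> s)) = (\<one> \<oplus> \<one>) \<otimes> ?e"
      using False c by (simp add: direction_def) algebra
    ultimately show ?thesis
      using a ss by (intro exI[of _ "\<one> \<oplus> \<one>"] exI[of _ "\<one> \<ominus> a \<otimes> a \<otimes> (s \<otimes> s)"]) simp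
  qed
  then obtain t n where tn: "t \<in> k" "n \<in> k" "?e \<otimes> ?e \<oplus> n = t \<otimes> ?e"
    and conj: "line (t \<ominus> ?e) = line (direction s (\<ominus> a))" by blast
  have "Q_loop R (line ?e) \<cong> Q_loop R (line (direction s b)) \<longleftrightarrow>
      line (direction s b) = line ?e \<or> line (direction s b) = line (direction s (\<ominus> a))"
    using Q_loop_line_iso_iff[OF p e e' tn] conj by simp
  also have "\<dots> \<longleftrightarrow> b = a \<or> b = \<ominus> a"
    using line_direction_inj[OF s b] a k_closed(5)[OF a] by metis
  also have "\<dots> \<longleftrightarrow> a = b \<or> a = \<ominus> b" using c by (metis minus_minus)
  finally show ?thesis .
qed

text \<open>Here \<open>k = {0, 1}\<close>, so the elements outside \<open>k\<close> are \<open>e\<close> and \<open>1 + e\<close>. In the quadratic equation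
  of \<open>e\<close> the trace \<open>t\<close> is \<open>1\<close>, since otherwise \<open>e\<^sup>2 = n = n\<^sup>2\<close> and \<open>e = n \<in> k\<close>. Thus
  \<open>1 + e = t - e\<close> is the conjugate of \<open>e\<close>.\<close>

lemma Q_loop_line_iso_char_2:
  assumes p: "p = 2" and e: "e \<in> carrier R - k" and e': "e' \<in> carrier R - k"
  shows "Q_loop R (line e') \<cong> Q_loop R (line e)"
proof -
  have c: "e \<in> carrier R" "e' \<in> carrier R" using e e' by auto
  have "{..<p} = {0, 1}" using p by auto
  hence k: "k = {\<zero>, \<one>}" using k_eq by auto
  have two: "\<one> \<oplus> \<one> = \<zero>"
    using nat_one_eq_zero_iff[of 2] nat_one_add[of 1 1] p by (simp add: numeral_2_eq_2)
  obtain t n where tn: "t \<in> k" "n \<in> k" "e \<otimes> e \<oplus> n = t \<otimes> e" by (rule quadratic_equation[OF e])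
  have n: "n \<in> carrier R" "n \<otimes> n = n" using tn(2) k by auto
  have "t \<noteq> \<zero>"
  proof
    assume "t = \<zero>"
    have "(e \<oplus> n) \<otimes> (e \<oplus> n) = (e \<otimes> e \<oplus> n \<otimes> n) \<oplus> (\<one> \<oplus> \<one>) \<otimes> (e \<otimes> n)" using c n(1) by algebra
    also have "\<dots> = \<zero>" using tn(3) c n \<open>t = \<zero>\<close> by (simp add: two)
    finally have "e \<oplus> n = \<zero>" using integral[of "e \<oplus> n" "e \<oplus> n"] c n by auto
    hence "e = \<ominus> n" using c n sum_zero_eq_neg by blast
    thus False using e tn(2) k_closed(5) by blast
  qed
  hence t: "t = \<one>" using tn(1) k by blast
  obtain x y where xy: "x \<in> k" "y \<in> k" "e' = x \<oplus> y \<otimes> e" using c(2) by (rule basis_exhaust[OF e])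
  have "y \<noteq> \<zero>" using xy e' c by auto
  hence y: "y = \<one>" using xy(2) k by blast
  have "\<ominus> e = e"
  proof (rule minus_equality)
    have "e \<oplus> e = (\<one> \<oplus> \<one>) \<otimes> e" using c by algebra
    thus "e \<oplus> e = \<zero>" using c by (simp add: two)
  qed (use c in auto)
  hence "e' = e \<or> e' = t \<ominus> e" using xy k c by (auto simp: y t minus_eq)
  moreover have "Q_loop R (line e') \<cong> Q_loop R (line e)" if "e' = t \<ominus> e"
  proof -
    have "Q_loop R (line (t \<ominus> e)) \<cong> Q_loop R (line (t \<ominus> (t \<ominus> e)))"
    proof (rule Q_loop_line_conjugate_iso[OF conjugate_notin_k[OF e tn(1)] tn(1,2)])
      have tc: "t \<in> carrier R" using tn(1) by simp
      have "(t \<ominus> e) \<otimes> (t \<ominus> e) \<oplus> n = (e \<otimes> e \<oplus> n) \<oplus> t \<otimes> (t \<ominus> e) \<ominus> t \<otimes> e" using c tc n(1) by algebra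
      also have "\<dots> = t \<otimes> (t \<ominus> e)" unfolding tn(3) using c tc by algebra
      finally show "(t \<ominus> e) \<otimes> (t \<ominus> e) \<oplus> n = t \<otimes> (t \<ominus> e)" .
    qed
    moreover have "t \<ominus> (t \<ominus> e) = e" using c tn(1)[THEN k_in_carrier] by algebra
    ultimately show ?thesis using that by simp
  qed
  ultimately show ?thesis using iso_refl by blast
qed

end

section \<open>Counting the isomorphism classes\<close>

lemma card_quotient_eq_card_representatives:
  assumes r: "equiv A r" and f: "f ` I \<subseteq> A" and ex1: "\<And>x. x \<in> A \<Longrightarrow> \<exists>!i. i \<in> I \<and> (x, f i) \<in> r"
  shows "card (A // r) = card I"
proof -
  have "bij_betw (\<lambda>i. r `` {f i}) I (A // r)"
  proof (rule bij_betwI')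
    fix i j assume ij: "i \<in> I" "j \<in> I"
    hence A: "f i \<in> A" "f j \<in> A" using f by auto
    hence "(f i, f i) \<in> r" using equiv_class_self[OF r] by blast
    hence "(f i, f j) \<in> r \<longleftrightarrow> i = j" using ex1[OF A(1)] ij by metis
    thus "r `` {f i} = r `` {f j} \<longleftrightarrow> i = j" using eq_equiv_class_iff[OF r A] by simp
  next
    fix i assume "i \<in> I"
    thus "r `` {f i} \<in> A // r" using f by (intro quotientI) blast
  next
    fix C assume "C \<in> A // r"
    then obtain x where x: "x \<in> A" "C = r `` {x}" by (rule quotientE)
    obtain i where "i \<in> I" "(x, f i) \<in> r" using ex1[OF x(1)] by blast
    thus "\<exists>i\<in>I. C = r `` {f i}" using x equiv_class_eq[OF r] by blast
  qed
  thus ?thesis by (simp add: bij_betw_same_card)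
qed

theorem theorem4p1:
  fixes K :: "('a, 'b) ring_scheme" (structure)
    and k :: "'a set" and p :: nat
  assumes "Factorial_Ring.prime p"
    and "field K" and "card (carrier K) = p ^ 2"
    and "subfield k K" and "card k = p"
  shows
    "(odd p \<longrightarrow>
       (\<forall>d \<in> k. \<not> (\<exists>x \<in> k. x [^] (2::nat) = d) \<longrightarrow>
         (\<exists>s \<in> carrier K. s [^] (2::nat) = d) \<and>
         (\<forall>s \<in> carrier K. s [^] (2::nat) = d \<longrightarrow>
           carrier K = {x \<oplus> y \<otimes> s | x y. x \<in> k \<and> y \<in> k} \<and>
           (\<forall>a \<in> k. Q_loop K (W_line K k s a) \<in> automorphic_Q_loops K k (p ^ 3)) \<and>
           (\<forall>a \<in> k. \<forall>b \<in> k.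
              Q_loop K (W_line K k s a) \<cong> Q_loop K (W_line K k s b) \<longleftrightarrow> a = b \<or> a = \<ominus> b) \<and>
           card (automorphic_Q_loops K k (p ^ 3) // iso_on (automorphic_Q_loops K k (p ^ 3)))
             = (p + 1) div 2 \<and>
           (\<forall>Q \<in> automorphic_Q_loops K k (p ^ 3).
              \<exists>!a::nat. a \<le> (p - 1) div 2 \<and> Q \<cong> Q_loop K (W_line K k s ([a] \<cdot> \<one>))))))
     \<and>
     (p = 2 \<longrightarrow>
       (\<exists>Q \<in> automorphic_Q_loops K k (p ^ 3).
          \<forall>Q' \<in> automorphic_Q_loops K k (p ^ 3). Q' \<cong> Q))"
proof -
  interpret F: prime_square_field K k p
    using assms by (simp add: prime_square_field_def prime_square_field_axioms_def)
  let ?A = "automorphic_Q_loops K k (p ^ 3)"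
  have sq: "s [^] (2::nat) = s \<otimes> s" if "s \<in> carrier K" for s
    using that by (simp add: numeral_2_eq_2)
  show ?thesis
  proof (intro conjI impI ballI)
    fix d assume "odd p" "d \<in> k"
    thus "\<exists>s \<in> carrier K. s [^] (2::nat) = d" using F.square_root_exists sq by metis
  next
    fix d s assume p: "odd p" and d: "d \<in> k" and non_square: "\<not> (\<exists>x \<in> k. x [^] (2::nat) = d)"
      and s: "s \<in> carrier K" and sd: "s [^] (2::nat) = d"
    have sk: "s \<in> carrier K - k" using s sd non_square by blast
    have ss: "s \<otimes> s \<in> k" using sd d sq[OF s] by simp
    have mem: "Q_loop K (W_line K k s a) \<in> ?A" if "a \<in> k" for a
      using F.automorphic_Q_loops_iff F.direction_notin_k[OF sk that] by (auto simp: F.W_line_eq_line)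
    have iso: "Q_loop K (W_line K k s a) \<cong> Q_loop K (W_line K k s b) \<longleftrightarrow> a = b \<or> a = \<ominus> b"
      if "a \<in> k" "b \<in> k" for a b
      using F.Q_loop_direction_iso_iff[OF p sk ss that] by (simp add: F.W_line_eq_line)
    have ex: "\<exists>a \<in> k. Q = Q_loop K (W_line K k s a)" if Q: "Q \<in> ?A" for Q
    proof -
      obtain e where "e \<in> carrier K - k" "Q = Q_loop K (F.line e)"
        using Q F.automorphic_Q_loops_iff by blast
      thus ?thesis using F.line_eq_line_direction[OF sk, of e] by (metis F.W_line_eq_line)
    qed
    have rep: "\<exists>!n. n \<le> (p - 1) div 2 \<and> Q \<cong> Q_loop K (W_line K k s ([n] \<cdot> \<one>))" if Q: "Q \<in> ?A" for Q
    proof -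
      obtain a where a: "a \<in> k" "Q = Q_loop K (W_line K k s a)" using ex[OF Q] by blast
      thus ?thesis using F.half_representative[OF p a(1)] iso[OF a(1) F.nat_one_in_k] by simp
    qed
    show "carrier K = {x \<oplus> y \<otimes> s | x y. x \<in> k \<and> y \<in> k}"
      using s by (auto elim: F.basis_exhaust[OF sk])
    show "Q_loop K (W_line K k s a) \<in> ?A" if "a \<in> k" for a by (rule mem[OF that])
    show "Q_loop K (W_line K k s a) \<cong> Q_loop K (W_line K k s b) \<longleftrightarrow> a = b \<or> a = \<ominus> b"
      if "a \<in> k" "b \<in> k" for a b by (rule iso[OF that])
    show "\<exists>!n. n \<le> (p - 1) div 2 \<and> Q \<cong> Q_loop K (W_line K k s ([n] \<cdot> \<one>))" if "Q \<in> ?A" for Q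
      by (rule rep[OF that])
    have "equiv ?A (iso_on ?A)"
    proof (rule equivI)
      show "iso_on ?A \<subseteq> ?A \<times> ?A" by (auto simp: iso_on_def)
      show "refl_on ?A (iso_on ?A)" by (auto simp: iso_on_def refl_on_def)
      show "trans (iso_on ?A)" by (auto simp: iso_on_def trans_def intro: iso_trans)
      \<comment> \<open>Symmetry can be read off from the classification, as \<open>a = \<plusminus>b\<close> is symmetric in \<open>a\<close> and \<open>b\<close>.\<close>
      show "sym (iso_on ?A)"
      proof (rule symI)
        fix P Q assume "(P, Q) \<in> iso_on ?A"
        hence PQ: "P \<in> ?A" "Q \<in> ?A" "P \<cong> Q" by (auto simp: iso_on_def)
        obtain a b where ab: "a \<in> k" "b \<in> k" "P = Q_loop K (W_line K k s a)" "Q = Q_loop K (W_line K k s b)"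
          using ex PQ(1,2) by metis
        hence "b = a \<or> b = \<ominus> a" using iso PQ(3) by (metis F.minus_minus F.k_in_carrier)
        thus "(Q, P) \<in> iso_on ?A" using PQ ab iso by (simp add: iso_on_def)
      qed
    qed
    hence "card (?A // iso_on ?A) = card {..(p - 1) div 2}"
    proof (rule card_quotient_eq_card_representatives)
      show "(\<lambda>n. Q_loop K (W_line K k s ([n] \<cdot> \<one>))) ` {..(p - 1) div 2} \<subseteq> ?A"
        using mem by auto
      fix Q assume Q: "Q \<in> ?A"
      show "\<exists>!n. n \<in> {..(p - 1) div 2} \<and> (Q, Q_loop K (W_line K k s ([n] \<cdot> \<one>))) \<in> iso_on ?A"
        using rep[OF Q] Q mem by (simp add: iso_on_def)
    qed
    also have "\<dots> = (p + 1) div 2" using p by (elim oddE) simp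
    finally show "card (?A // iso_on ?A) = (p + 1) div 2" .
  next
    assume p: "p = 2"
    have "card k < card (carrier K)" using assms p by simp
    hence "\<not> carrier K \<subseteq> k" using card_mono[OF F.finite_k, of "carrier K"] by linarith
    then obtain e where e: "e \<in> carrier K - k" by blast
    have "Q' \<cong> Q_loop K (F.line e)" if Q': "Q' \<in> ?A" for Q'
    proof -
      obtain e' where "e' \<in> carrier K - k" "Q' = Q_loop K (F.line e')"
        using F.automorphic_Q_loops_iff[THEN iffD1, OF Q'] by blast
      thus ?thesis using F.Q_loop_line_iso_char_2[OF p e] by simp
    qed
    moreover have "Q_loop K (F.line e) \<in> ?A"
      by (rule F.automorphic_Q_loops_iff[THEN iffD2, OF bexI[OF refl e]])
    ultimately show "\<exists>Q \<in> ?A. \<forall>Q' \<in> ?A. Q' \<cong> Q" by blast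
  qed
qed

end
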